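(* Let $B$ be a unital C*-algebra and let $\{\mathcal{M},\langle\cdot,\cdot\rangle_{\mathcal{M}}\}$ and $\{\mathcal{N},\langle\cdot,\cdot\rangle_{\mathcal{N}}\}$ be two finitely generated Hilbert $B$-modules. Then the following conditions are equivalent: (i) $\mathcal{M}$ and $\mathcal{N}$ are algebraically isomorphic as projective $B$-modules. (ii) $\{\mathcal{M},\|\cdot\|_{\mathcal{M}}\}$ and $\{\mathcal{N},\|\cdot\|_{\mathcal{N}}\}$ are isometrically isomorphic as Banach $B$-modules. (iii) $\{\mathcal{M},\langle\cdot,\cdot\rangle_{\mathcal{M}}\}$ and $\{\mathcal{N},\langle\cdot,\cdot\rangle_{\mathcal{N}}\}$ are unitarily isomorphic as Hilbert $B$-modules. (iv) There are finite normalized tight (modular) frames $\{x_1,\dots,x_k\}$ of $\mathcal{M}$ and $\{y_1,\dots,y_l\}$ of $\mathcal{N}$ such that $k=l$, $x_i\neq 0$ and $y_i\neq 0$ for any $i=1,\dots,k$, and $\langle x_i,x_j\rangle_{\mathcal{M}}=\langle y_i,y_j\rangle_{\mathcal{N}}$ for any $i,j=1,\dots,k$.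
   Context: A Hilbert $B$-module is a left $B$-module $\mathcal{M}$ with a map $\langle\cdot,\cdot\rangle_{\mathcal{M}}:\mathcal{M}\times\mathcal{M}\to B$ (the $B$-valued inner product) such that $\langle x,x\rangle\ge 0$; $\langle x,x\rangle=0$ iff $x=0$; $\langle x,y\rangle=\langle y,x\rangle^*$; $\langle ax+by,z\rangle=a\langle x,z\rangle+b\langle y,z\rangle$ for $a,b\in B$, $x,y,z\in\mathcal{M}$; and $\mathcal{M}$ is complete for the norm $\|x\|_{\mathcal{M}}=\|\langle x,x\rangle_{\mathcal{M}}\|_B^{1/2}$. It is finitely generated if it is finitely generated algebraically as a $B$-module (it is then projective). Two Hilbert $B$-modules are unitarily isomorphic if there is a bijective $B$-linear map between them preserving the $B$-valued inner products. A finite normalized tight (modular) frame of $\mathcal{M}$ is a $k$-tuple $\{x_1,\dots,x_k\}$ of elements of $\mathcal{M}$ such that $\langle x,x\rangle_{\mathcal{M}}=\sum_{i=1}^k\langle x,x_i\rangle_{\mathcal{M}}\langle x_i,x\rangle_{\mathcal{M}}$ for every $x\in\mathcal{M}$. *)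

theory Defs
  imports "HOL-Analysis.Analysis"
begin

text \<open>
  Combining \<^class>\<open>real_normed_algebra\<close> with \<^class>\<open>monoid_mult\<close>, instead of using
  \<^class>\<open>real_normed_algebra_1\<close>, keeps the zero algebra among the unital C*-algebras; in every other
  case \<open>norm 1 = 1\<close> follows from the C*-identity.
\<close>

class unital_cstar_algebra = real_normed_algebra + monoid_mult + banach +
  fixes scaleC :: "complex \<Rightarrow> 'a \<Rightarrow> 'a"  (infixr "*\<^sub>C" 75)
    and star :: "'a \<Rightarrow> 'a"
  assumes scaleC_add_right: "c *\<^sub>C (x + y) = c *\<^sub>C x + c *\<^sub>C y"
    and scaleC_add_left: "(c + d) *\<^sub>C x = c *\<^sub>C x + d *\<^sub>C x"
    and scaleC_scaleC: "c *\<^sub>C d *\<^sub>C x = (c * d) *\<^sub>C x"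
    and scaleC_of_real: "complex_of_real r *\<^sub>C x = r *\<^sub>R x"
    and mult_scaleC_left: "(c *\<^sub>C x) * y = c *\<^sub>C (x * y)"
    and mult_scaleC_right: "x * (c *\<^sub>C y) = c *\<^sub>C (x * y)"
    and norm_scaleC: "norm (c *\<^sub>C x) = cmod c * norm x"
    and star_star: "star (star x) = x"
    and star_add: "star (x + y) = star x + star y"
    and star_mult: "star (x * y) = star y * star x"
    and star_scaleC: "star (c *\<^sub>C x) = cnj c *\<^sub>C star x"
    and cstar_identity: "norm (star x * x) = (norm x)\<^sup>2"

definition cstar_spectrum :: "'b::unital_cstar_algebra \<Rightarrow> complex set" where
  "cstar_spectrum a = {z. \<not> (\<exists>c. c * (a - z *\<^sub>C 1) = 1 \<and> (a - z *\<^sub>C 1) * c = 1)}"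

definition cstar_positive :: "'b::unital_cstar_algebra \<Rightarrow> bool" where
  "cstar_positive a \<longleftrightarrow> star a = a \<and> cstar_spectrum a \<subseteq> \<real>\<^sub>\<ge>\<^sub>0"

text \<open>
  The library locale \<^locale>\<open>module\<close> is restricted to commutative rings.
  Over a unital C*-algebra the complex scalars act through \<open>z *\<^sub>C 1\<close>, so no
  separate complex structure on the module is needed, and B-linear maps are complex linear.
\<close>

locale left_module =
  fixes act :: "'b::unital_cstar_algebra \<Rightarrow> 'm::ab_group_add \<Rightarrow> 'm"
  assumes act_add_right: "act a (x + y) = act a x + act a y"
    and act_add_left: "act (a + b) x = act a x + act b x"
    and act_act: "act a (act b x) = act (a * b) x"
    and act_one: "act 1 x = x"

definition finitely_generated ::
    "('b::unital_cstar_algebra \<Rightarrow> 'm::ab_group_add \<Rightarrow> 'm) \<Rightarrow> bool" where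
  "finitely_generated act \<longleftrightarrow>
     (\<exists>G. finite G \<and> (\<forall>x. \<exists>c. x = (\<Sum>g\<in>G. act (c g) g)))"

definition hilbert_norm :: "('m \<Rightarrow> 'm \<Rightarrow> 'b::unital_cstar_algebra) \<Rightarrow> 'm \<Rightarrow> real" where
  "hilbert_norm ip x = sqrt (norm (ip x x))"

locale hilbert_module = left_module act
  for act :: "'b::unital_cstar_algebra \<Rightarrow> 'm::ab_group_add \<Rightarrow> 'm" +
  fixes ip :: "'m \<Rightarrow> 'm \<Rightarrow> 'b"
  assumes ip_positive: "cstar_positive (ip x x)"
    and ip_eq_zero_iff: "ip x x = 0 \<longleftrightarrow> x = 0"
    and ip_star: "ip x y = star (ip y x)"
    and ip_linear: "ip (act a x + act b y) z = a * ip x z + b * ip y z"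
    and complete:
      "(\<forall>e>0. \<exists>N. \<forall>m\<ge>N. \<forall>n\<ge>N. hilbert_norm ip (X m - X n) < e) \<Longrightarrow>
       \<exists>x. (\<lambda>n. hilbert_norm ip (X n - x)) \<longlonglongrightarrow> 0"

definition module_iso ::
    "('b::unital_cstar_algebra \<Rightarrow> 'm::ab_group_add \<Rightarrow> 'm) \<Rightarrow>
     ('b \<Rightarrow> 'n::ab_group_add \<Rightarrow> 'n) \<Rightarrow> ('m \<Rightarrow> 'n) \<Rightarrow> bool" where
  "module_iso actM actN T \<longleftrightarrow>
     bij T \<and> (\<forall>x y. T (x + y) = T x + T y) \<and> (\<forall>a x. T (actM a x) = actN a (T x))"

definition algebraically_isomorphic ::
    "('b::unital_cstar_algebra \<Rightarrow> 'm::ab_group_add \<Rightarrow> 'm) \<Rightarrow>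
     ('b \<Rightarrow> 'n::ab_group_add \<Rightarrow> 'n) \<Rightarrow> bool" where
  "algebraically_isomorphic actM actN \<longleftrightarrow> (\<exists>T. module_iso actM actN T)"

definition isometrically_isomorphic ::
    "('b::unital_cstar_algebra \<Rightarrow> 'm::ab_group_add \<Rightarrow> 'm) \<Rightarrow> ('m \<Rightarrow> 'm \<Rightarrow> 'b) \<Rightarrow>
     ('b \<Rightarrow> 'n::ab_group_add \<Rightarrow> 'n) \<Rightarrow> ('n \<Rightarrow> 'n \<Rightarrow> 'b) \<Rightarrow> bool" where
  "isometrically_isomorphic actM ipM actN ipN \<longleftrightarrow>
     (\<exists>T. module_iso actM actN T \<and> (\<forall>x. hilbert_norm ipN (T x) = hilbert_norm ipM x))"

definition unitarily_isomorphic ::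
    "('b::unital_cstar_algebra \<Rightarrow> 'm::ab_group_add \<Rightarrow> 'm) \<Rightarrow> ('m \<Rightarrow> 'm \<Rightarrow> 'b) \<Rightarrow>
     ('b \<Rightarrow> 'n::ab_group_add \<Rightarrow> 'n) \<Rightarrow> ('n \<Rightarrow> 'n \<Rightarrow> 'b) \<Rightarrow> bool" where
  "unitarily_isomorphic actM ipM actN ipN \<longleftrightarrow>
     (\<exists>T. module_iso actM actN T \<and> (\<forall>x y. ipN (T x) (T y) = ipM x y))"

text \<open>
  A k-tuple is a list of length k. The empty list is admitted: it is the only frame of the zero
  module without zero entries.
\<close>

definition normalized_tight_frame ::
    "('m \<Rightarrow> 'm \<Rightarrow> 'b::unital_cstar_algebra) \<Rightarrow> 'm list \<Rightarrow> bool" where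
  "normalized_tight_frame ip xs \<longleftrightarrow>
     (\<forall>x. ip x x = (\<Sum>i<length xs. ip x (xs ! i) * ip (xs ! i) x))"

end

theory Submission
  imports Defs
begin

text \<open>
  Given generators of a Hilbert module, the frame operator \<open>S x = \<Sum>i. \<langle>x, g\<^sub>i\<rangle> g\<^sub>i\<close> is positive and, by
  completeness of the module, bounded below; hence it is bijective and has an invertible positive
  square root \<open>R\<close>. The elements \<open>R\<^sup>-\<^sup>1 g\<^sub>i\<close> form a normalized tight frame. If \<open>T\<close> is an algebraic
  isomorphism from \<open>M\<close> to \<open>N\<close> and \<open>x\<^sub>i\<close> is such a frame of \<open>M\<close>, the same construction applied to the
  generators \<open>T x\<^sub>i\<close> of \<open>N\<close> gives an isomorphism \<open>V\<close> carrying \<open>x\<^sub>i\<close> to a frame of \<open>N\<close>. The Gram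
  matrices of \<open>x\<^sub>i\<close> and \<open>V x\<^sub>i\<close> are self-adjoint projections with the same kernel, so they are equal,
  and equality of the Gram matrices makes \<open>x \<mapsto> \<Sum>i. \<langle>x, x\<^sub>i\<rangle> V x\<^sub>i\<close> unitary.

  The order theory of C*-algebras needed for this rests on the fact that the norm of a self-adjoint
  element is attained on its spectrum, proved without holomorphic functional calculus.
\<close>

section \<open>Invertible elements and spectra\<close>

text \<open>An algebraic isomorphism \<open>T\<close> comes with neither a bound nor an adjoint, so
  its polar decomposition cannot be formed directly. The frame operator \<open>S\<close> of the
  images \<open>T x\<^sub>i\<close> is self-adjoint by construction, requires no continuity of
  \<open>T\<close>, and would equal \<open>T T\<^sup>*\<close> if the adjoint were known; thus
  \<open>V = S\<^sup>-\<^sup>1\<^sup>/\<^sup>2 T\<close> is the unitary polar factor, and the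
  unitary map obtained at the end is \<open>V\<close> itself. Positivity is defined by the spectrum,
  so even closure under sums has to be proved; attainment of the norm on the spectrum turns
  positivity into the convex condition \<open>norm (t *\<^sub>R 1 - a) \<le> t\<close>. The module
  type carries no norm or real scaling of its own: a real \<open>r\<close> acts as
  \<open>r *\<^sub>R 1\<close>, and completeness enters through fixed points of contractions and
  Baire category.\<close>

lemma scaleC_1 [simp]: "1 *\<^sub>C (x::'b::unital_cstar_algebra) = x"
  using scaleC_of_real[of 1 x] by simp

lemma scaleC_0 [simp]: "0 *\<^sub>C (x::'b::unital_cstar_algebra) = 0"
  using scaleC_of_real[of 0 x] by simp

lemma scaleC_minus_left: "(- c) *\<^sub>C (x::'b::unital_cstar_algebra) = - (c *\<^sub>C x)"
  using scaleC_add_left[of "- c" c x] by (simp add: eq_neg_iff_add_eq_0)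

lemma scaleC_diff_left: "(c - d) *\<^sub>C (x::'b::unital_cstar_algebra) = c *\<^sub>C x - d *\<^sub>C x"
  using scaleC_add_left[of c "- d" x] by (simp add: scaleC_minus_left)

lemma scaleC_0_right [simp]: "c *\<^sub>C (0::'b::unital_cstar_algebra) = 0"
  using scaleC_add_right[of c 0 "0::'b"] by simp

lemma scaleC_minus_right: "c *\<^sub>C (- x) = - (c *\<^sub>C (x::'b::unital_cstar_algebra))"
  using scaleC_add_right[of c x "- x"] by (simp add: eq_neg_iff_add_eq_0 add.commute)

lemma scaleC_diff_right: "c *\<^sub>C (x - y) = c *\<^sub>C x - c *\<^sub>C (y::'b::unital_cstar_algebra)"
  using scaleC_add_right[of c x "- y"] by (simp add: scaleC_minus_right)

lemma scaleC_power: "(c *\<^sub>C x) ^ n = c ^ n *\<^sub>C (x::'b::unital_cstar_algebra) ^ n"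
  by (induction n) (simp_all add: mult_scaleC_left mult_scaleC_right scaleC_scaleC mult.commute)

lemma star_zero [simp]: "star (0::'b::unital_cstar_algebra) = 0"
  using star_add[of 0 "0::'b"] by simp

lemma star_minus: "star (- x) = - star (x::'b::unital_cstar_algebra)"
  using star_add[of x "- x"] by (simp add: eq_neg_iff_add_eq_0 add.commute)

lemma star_diff: "star (x - y) = star x - star (y::'b::unital_cstar_algebra)"
  using star_add[of x "- y"] by (simp add: star_minus)

lemma star_one [simp]: "star (1::'b::unital_cstar_algebra) = 1"
  using star_mult[of "star 1" "1::'b"] by (simp add: star_star)

lemma star_scaleR: "star (r *\<^sub>R x) = r *\<^sub>R star (x::'b::unital_cstar_algebra)"
  using star_scaleC[of "complex_of_real r" x] by (simp add: scaleC_of_real)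

lemma star_sum: "star (\<Sum>i\<in>A. f i) = (\<Sum>i\<in>A. star (f i :: 'b::unital_cstar_algebra))"
  by (induction A rule: infinite_finite_induct) (simp_all add: star_add)

lemma norm_star: "norm (star x) = norm (x::'b::unital_cstar_algebra)"
proof -
  have le: "norm y \<le> norm (star y)" for y :: 'b
  proof -
    have "(norm y)\<^sup>2 \<le> norm (star y) * norm y"
      by (metis cstar_identity norm_mult_ineq)
    then show ?thesis
      by (cases "norm y = 0") (simp_all add: power2_eq_square)
  qed
  from le[of x] le[of "star x"] show ?thesis by (simp add: star_star)
qed

lemma norm_mult_star: "norm (x * star x) = (norm (x::'b::unital_cstar_algebra))\<^sup>2"
  using cstar_identity[of "star x"] by (simp add: star_star norm_star)

lemma norm_square_selfadjoint:
  "star h = h \<Longrightarrow> norm (h * h) = (norm (h::'b::unital_cstar_algebra))\<^sup>2"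
  using cstar_identity[of h] by simp

lemma norm_one_le: "norm (1::'b::unital_cstar_algebra) \<le> 1"
proof -
  have "norm (1::'b) * norm (1::'b) = norm (1::'b)"
    using cstar_identity[of "1::'b"] by (simp add: power2_eq_square)
  then show ?thesis by (metis mult_cancel_right1 order_refl zero_le_one)
qed

lemma norm_scaleR_one_le: "norm (r *\<^sub>R (1::'b::unital_cstar_algebra)) \<le> \<bar>r\<bar>"
  using mult_left_mono[OF norm_one_le, of "\<bar>r\<bar>"] by simp

definition inverses :: "'a::monoid_mult \<Rightarrow> 'a \<Rightarrow> bool" where
  "inverses a c \<longleftrightarrow> c * a = 1 \<and> a * c = 1"

lemma cstar_spectrum_alt: "z \<in> cstar_spectrum a \<longleftrightarrow> \<not> (\<exists>c. inverses (a - z *\<^sub>C 1) c)"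
  by (simp add: cstar_spectrum_def inverses_def)

lemma inversesI:
  fixes a :: "'a::monoid_mult"
  assumes "c * a = 1" "a * d = 1"
  shows "inverses a c"
  by (metis assms inverses_def mult.assoc mult_1 mult_1_right)

lemma inverses_scaleC:
  fixes a :: "'b::unital_cstar_algebra"
  assumes "inverses a c" "z \<noteq> 0"
  shows "inverses (z *\<^sub>C a) (inverse z *\<^sub>C c)"
  using assms by (simp add: inverses_def mult_scaleC_left mult_scaleC_right scaleC_scaleC)

lemma inverses_minus:
  fixes a :: "'b::unital_cstar_algebra"
  shows "inverses a c \<Longrightarrow> inverses (- a) (- c)"
  by (simp add: inverses_def)

lemma inverses_mult:
  fixes a b :: "'a::monoid_mult"
  assumes "inverses a c" "inverses b d"
  shows "inverses (a * b) (d * c)"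
  using assms unfolding inverses_def by (metis mult.assoc mult_1_right)

text \<open>Two contractions replace the geometric series: the fixed point of
  \<open>1 + a * x\<close> is a right inverse, that of \<open>1 + x * a\<close> a left
  inverse.\<close>

lemma neumann:
  fixes a :: "'b::unital_cstar_algebra"
  assumes "norm a < 1"
  shows "\<exists>c. inverses (1 - a) c"
proof -
  have d: "dist (1 + a * x) (1 + a * y) \<le> norm a * dist x y"
    "dist (1 + x * a) (1 + y * a) \<le> norm a * dist x y" for x y
    using norm_mult_ineq[of a "x - y"] norm_mult_ineq[of "x - y" a]
    by (simp_all add: dist_norm algebra_simps)
  obtain x where x: "1 + a * x = x"
    using banach_fix_type[of "norm a" "\<lambda>x. 1 + a * x"] d(1) assms norm_ge_zero[of a] by metis
  obtain y where y: "1 + y * a = y"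
    using banach_fix_type[of "norm a" "\<lambda>x. 1 + x * a"] d(2) assms norm_ge_zero[of a] by metis
  have "y * (1 - a) = 1" "(1 - a) * x = 1"
    using x y by (simp_all add: algebra_simps)
  then show ?thesis using inversesI by blast
qed

lemma spectrum_norm_le:
  fixes a :: "'b::unital_cstar_algebra"
  assumes "z \<in> cstar_spectrum a"
  shows "cmod z \<le> norm a"
proof (rule ccontr)
  assume "\<not> cmod z \<le> norm a"
  then have z: "norm a < cmod z" by simp
  then have "z \<noteq> 0" using norm_ge_zero[of a] by (metis leD norm_zero)
  moreover have "norm (inverse z *\<^sub>C a) < 1"
    using z \<open>z \<noteq> 0\<close> by (simp add: norm_scaleC norm_inverse pos_divide_less_eq flip: divide_inverse_commute)
  then obtain c where "inverses (1 - inverse z *\<^sub>C a) c"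
    using neumann by blast
  from inverses_scaleC[OF this, of "- z"] \<open>z \<noteq> 0\<close>
  have "\<exists>c. inverses (a - z *\<^sub>C 1) c"
    by (auto simp: scaleC_diff_right scaleC_scaleC scaleC_minus_left)
  then show False using assms by (simp add: cstar_spectrum_alt)
qed

lemma spectrum_shift:
  fixes a :: "'b::unital_cstar_algebra"
  assumes "z \<in> cstar_spectrum a"
  shows "z + w \<in> cstar_spectrum (a + w *\<^sub>C 1)"
  using assms by (simp add: cstar_spectrum_alt scaleC_add_left)

lemma spectrum_minus:
  fixes a :: "'b::unital_cstar_algebra"
  assumes "z \<in> cstar_spectrum a"
  shows "- z \<in> cstar_spectrum (- a)"
proof (rule ccontr)
  assume "\<not> - z \<in> cstar_spectrum (- a)"
  then obtain c where "inverses (- a + z *\<^sub>C 1) c"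
    by (auto simp: cstar_spectrum_alt scaleC_minus_left)
  from inverses_minus[OF this] show False
    using assms by (auto simp: cstar_spectrum_alt)
qed

text \<open>Shifting \<open>h\<close> by \<open>i \<lambda>\<close> moves a nonreal \<open>z\<close> farther from the origin than the norm of the shifted
  element, by the C*-identity.\<close>

lemma spectrum_selfadjoint_real:
  fixes h :: "'b::unital_cstar_algebra"
  assumes h: "star h = h" and z: "z \<in> cstar_spectrum h"
  shows "Im z = 0"
proof (rule ccontr)
  assume q: "Im z \<noteq> 0"
  \<comment> \<open>Chosen so that the cross term \<open>2 * Im z * l\<close> of
    \<open>(cmod (z + w))\<^sup>2\<close> exceeds \<open>(norm h)\<^sup>2\<close> by 1; the terms
    \<open>l * l\<close> cancel.\<close>
  define l where "l = ((norm h)\<^sup>2 + 1) / (2 * Im z)"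
  have l: "2 * Im z * l = (norm h)\<^sup>2 + 1" using q by (simp add: l_def)
  define w where "w = complex_of_real l * \<i>"
  have ww: "(w * w) = complex_of_real (- (l * l))" by (simp add: w_def complex_eq_iff)
  have "star (h + w *\<^sub>C 1) * (h + w *\<^sub>C 1) = h * h + (l * l) *\<^sub>R 1"
  proof -
    have "star (h + w *\<^sub>C 1) = h - w *\<^sub>C 1"
      by (simp add: star_add star_scaleC h w_def flip: scaleC_minus_left)
    then have "star (h + w *\<^sub>C 1) * (h + w *\<^sub>C 1) = h * h - (w * w) *\<^sub>C 1"
      by (simp only: left_diff_distrib distrib_left mult_scaleC_left mult_scaleC_right scaleC_scaleC
          scaleC_diff_right) (simp add: mult_scaleC_right)
    then show ?thesis by (simp only: ww scaleC_of_real) simp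
  qed
  then have "(norm (h + w *\<^sub>C 1))\<^sup>2 = norm (h * h + (l * l) *\<^sub>R 1)"
    by (metis cstar_identity)
  also have "\<dots> \<le> (norm h)\<^sup>2 + l * l"
    using norm_triangle_ineq[of "h * h" "(l * l) *\<^sub>R 1"] norm_scaleR_one_le[of "l * l", where 'b = 'b]
    by (simp add: norm_square_selfadjoint h)
  finally have "(norm (h + w *\<^sub>C 1))\<^sup>2 \<le> (norm h)\<^sup>2 + l * l" .
  moreover have "(cmod (z + w))\<^sup>2 \<le> (norm (h + w *\<^sub>C 1))\<^sup>2"
    using spectrum_norm_le[OF spectrum_shift[OF z, of w]] by (simp add: power_mono)
  moreover have "(cmod (z + w))\<^sup>2 = (Re z)\<^sup>2 + (Im z)\<^sup>2 + 2 * Im z * l + l * l"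
    unfolding cmod_power2 by (simp add: w_def power2_eq_square algebra_simps)
  ultimately have "(Re z)\<^sup>2 + (Im z)\<^sup>2 + 1 \<le> 0"
    using l by linarith
  then show False
    using zero_le_power2[of "Re z"] zero_le_power2[of "Im z"] by linarith
qed

section \<open>The norm of a self-adjoint element as a point of its spectrum\<close>

text \<open>The C*-identity controls squaring, which is why the powers below have exponent
  \<open>2 ^ k\<close>.\<close>

lemma norm_power_selfadjoint:
  fixes h :: "'b::unital_cstar_algebra"
  assumes "star h = h"
  shows "star (h ^ 2 ^ k) = h ^ 2 ^ k \<and> norm (h ^ 2 ^ k) = norm h ^ 2 ^ k"
proof (induction k)
  case (Suc k)
  have "h ^ 2 ^ Suc k = h ^ 2 ^ k * h ^ 2 ^ k"
    by (simp add: mult_2 power_add)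
  then show ?case using Suc
    by (simp add: star_mult norm_square_selfadjoint mult_2 power_add power2_eq_square)
qed (simp add: assms)

text \<open>The resolvent identity \<open>f w - f v = f w * ((w - v) *\<^sub>C h) * f v\<close>
  turns a bound on \<open>f\<close> into a Lipschitz constant; the bound exists because the same
  identity first gives continuity, and the disc is compact.\<close>

lemma resolvent_lipschitz:
  fixes h :: "'b::unital_cstar_algebra"
  assumes h: "norm h \<le> 1"
    and f: "\<And>w. cmod w \<le> 1 \<Longrightarrow> inverses (1 - w *\<^sub>C h) (f w)"
  shows "\<exists>L\<ge>0. \<forall>w v. cmod w \<le> 1 \<longrightarrow> cmod v \<le> 1 \<longrightarrow> norm (f w - f v) \<le> L * cmod (w - v)"
proof -
  have res: "norm (f w - f v) \<le> cmod (w - v) * norm (f w) * norm (f v)"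
    if "cmod w \<le> 1" "cmod v \<le> 1" for w v
  proof -
    have "f w * ((1 - v *\<^sub>C h) - (1 - w *\<^sub>C h)) * f v = f w * ((1 - v *\<^sub>C h) * f v) - (f w * (1 - w *\<^sub>C h)) * f v"
      by (simp add: algebra_simps)
    also have "\<dots> = f w - f v"
      using f[OF that(1)] f[OF that(2)] by (simp add: inverses_def)
    finally have "f w - f v = f w * ((w - v) *\<^sub>C h) * f v"
      by (simp add: scaleC_diff_left)
    also have "norm \<dots> \<le> norm (f w) * norm ((w - v) *\<^sub>C h) * norm (f v)"
      by (meson mult_right_mono norm_ge_zero norm_mult_ineq order_trans)
    also have "\<dots> \<le> norm (f w) * cmod (w - v) * norm (f v)"
      using mult_left_mono[OF h, of "cmod (w - v)"]
      by (auto simp: norm_scaleC intro!: mult_right_mono mult_left_mono)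
    finally show ?thesis by (simp add: mult_ac)
  qed
  have "continuous_on (cball 0 1) f"
    unfolding continuous_on_iff
  proof (intro ballI allI impI)
    fix v and e :: real assume v: "v \<in> cball (0::complex) 1" and e: "0 < e"
    define m where "m = norm (f v) + 1"
    have m: "0 < m" "norm (f v) \<le> m" by (simp_all add: m_def add_nonneg_pos)
    \<comment> \<open>The first bound yields \<open>norm (f w) \<le> 2 * m\<close>; given this, the
      second makes the estimate at most \<open>e / 2\<close>.\<close>
    define d where "d = min (1 / (2 * m)) (e / (4 * m * m))"
    have "dist (f w) (f v) < e" if w: "w \<in> cball 0 1" and wd: "dist w v < d" for w
    proof -
      have d: "cmod (w - v) \<le> 1 / (2 * m)" "cmod (w - v) < e / (4 * m * m)"
        using wd by (auto simp: d_def dist_norm)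
      have r: "norm (f w - f v) \<le> cmod (w - v) * norm (f w) * norm (f v)"
        using res v w by simp
      also have "\<dots> \<le> (1 / (2 * m)) * norm (f w) * m"
        using d m by (intro mult_mono) auto
      finally have "norm (f w - f v) \<le> norm (f w) / 2" using m by simp
      then have fw: "norm (f w) \<le> 2 * m"
        using norm_triangle_ineq2[of "f w" "f v"] m by linarith
      note r
      also have "cmod (w - v) * norm (f w) * norm (f v) \<le> cmod (w - v) * (2 * m) * m"
        using fw m by (intro mult_mono) auto
      also have "\<dots> \<le> e / (4 * m * m) * (2 * m) * m"
        using d(2) m by (intro mult_right_mono) auto
      also have "\<dots> = e / 2" using m by (simp add: field_simps)
      finally show ?thesis using e by (simp add: dist_norm)
    qed
    moreover have "d > 0" using m e by (simp add: d_def)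
    ultimately show "\<exists>d>0. \<forall>w\<in>cball 0 1. dist w v < d \<longrightarrow> dist (f w) (f v) < e" by blast
  qed
  then have "bounded (f ` cball 0 1)"
    by (intro compact_imp_bounded compact_continuous_image compact_cball)
  then obtain M where M: "\<And>w. cmod w \<le> 1 \<Longrightarrow> norm (f w) \<le> M" and "M \<ge> 0"
    by (metis (no_types, lifting) bounded_pos imageI less_imp_le mem_cball_0)
  have "norm (f w - f v) \<le> M * M * cmod (w - v)" if "cmod w \<le> 1" "cmod v \<le> 1" for w v
  proof -
    have "cmod (w - v) * norm (f w) * norm (f v) \<le> cmod (w - v) * M * M"
      using M that \<open>M \<ge> 0\<close> by (intro mult_mono) auto
    then show ?thesis using res[OF that] by (simp add: mult_ac)
  qed
  then show ?thesis using \<open>M \<ge> 0\<close> by (intro exI[of _ "M * M"]) simp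
qed

text \<open>Partial fractions:
  \<open>2 / (1 - a\<^sup>2) = 1 / (1 - a) + 1 / (1 + a)\<close>.\<close>

lemma inverses_one_minus_square:
  fixes a :: "'b::unital_cstar_algebra"
  assumes u: "inverses (1 - a) u" and v: "inverses (1 + a) v"
  shows "inverses (1 - a * a) ((1/2) *\<^sub>R (u + v))"
proof -
  have e: "1 - a * a = (1 + a) * (1 - a)" "1 - a * a = (1 - a) * (1 + a)"
    by (simp_all add: algebra_simps)
  have "(1 - a * a) * u = 1 + a" "u * (1 - a * a) = 1 + a"
    using u unfolding inverses_def by (simp only: e(1) mult.assoc, simp, simp only: e(2) flip: mult.assoc, simp)
  moreover have "(1 - a * a) * v = 1 - a" "v * (1 - a * a) = 1 - a"
    using v unfolding inverses_def by (simp only: e(2) mult.assoc, simp, simp only: e(1) flip: mult.assoc, simp)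
  ultimately show ?thesis
    by (simp add: inverses_def distrib_left distrib_right flip: scaleR_2)
qed

text \<open>The inverse of \<open>1 - a\<^sup>n\<close> is the average of the inverses of \<open>1 - \<zeta> a\<close> over the \<open>n\<close>-th roots of
  unity \<open>\<zeta>\<close>, so it inherits the Lipschitz constant of the resolvent, uniformly in \<open>n\<close>.\<close>

lemma resolvent_power_lipschitz:
  fixes h :: "'b::unital_cstar_algebra"
  assumes f: "\<And>w. cmod w \<le> 1 \<Longrightarrow> inverses (1 - w *\<^sub>C h) (f w)"
    and lip: "\<And>w v. cmod w \<le> 1 \<Longrightarrow> cmod v \<le> 1 \<Longrightarrow> norm (f w - f v) \<le> L * cmod (w - v)"
    and "0 \<le> L"
  shows "\<exists>g. \<forall>w. cmod w \<le> 1 \<longrightarrow> inverses (1 - (w *\<^sub>C h) ^ 2 ^ k) (g w) \<and>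
           (\<forall>r. 0 \<le> r \<longrightarrow> r \<le> 1 \<longrightarrow> norm (g (complex_of_real r * w) - g w) \<le> L * (1 - r))"
proof (induction k)
  case 0
  have "norm (f (complex_of_real r * w) - f w) \<le> L * (1 - r)"
    if "cmod w \<le> 1" "0 \<le> r" "r \<le> 1" for r w
  proof -
    have "cmod (complex_of_real r * w - w) = cmod (complex_of_real (r - 1)) * cmod w"
      by (metis mult.left_neutral norm_mult of_real_1 of_real_diff left_diff_distrib)
    also have "\<dots> \<le> 1 - r"
      using that by (simp add: norm_of_real mult_left_le del: of_real_diff)
    finally have "cmod (complex_of_real r * w - w) \<le> 1 - r" .
    moreover have "cmod (complex_of_real r * w) \<le> 1"
      using that by (simp add: norm_mult mult_le_one)
    ultimately show ?thesis
      using lip[of "complex_of_real r * w" w] that(1) \<open>0 \<le> L\<close> by (meson mult_left_mono order_trans)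
  qed
  then show ?case using f by (intro exI[of _ f]) simp
next
  case (Suc k)
  then obtain g where g: "\<And>w. cmod w \<le> 1 \<Longrightarrow> inverses (1 - (w *\<^sub>C h) ^ 2 ^ k) (g w)"
    and gl: "\<And>w r. cmod w \<le> 1 \<Longrightarrow> 0 \<le> r \<Longrightarrow> r \<le> 1 \<Longrightarrow>
      norm (g (complex_of_real r * w) - g w) \<le> L * (1 - r)"
    by blast
  \<comment> \<open>A \<open>2 ^ k\<close>-th root of -1: replacing \<open>w\<close> by
    \<open>w * z\<close> negates \<open>(w *\<^sub>C h) ^ 2 ^ k\<close>, so the partial fractions
    double the exponent.\<close>
  define z where "z = cis (pi / 2 ^ k)"
  have z: "z ^ 2 ^ k = - 1" by (simp add: z_def Complex.DeMoivre)
  have zn: "cmod (w * z) = cmod w" for w by (simp add: z_def norm_mult)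
  define g' where "g' w = (1/2) *\<^sub>R (g w + g (w * z))" for w
  have "inverses (1 - (w *\<^sub>C h) ^ 2 ^ Suc k) (g' w)" if "cmod w \<le> 1" for w
  proof -
    define a where "a = (w *\<^sub>C h) ^ 2 ^ k"
    have "((w * z) *\<^sub>C h) ^ 2 ^ k = - a"
      by (simp add: a_def scaleC_power power_mult_distrib z scaleC_minus_left)
    then have v: "inverses (1 + a) (g (w * z))" using g[of "w * z"] that by (simp add: zn)
    have u: "inverses (1 - a) (g w)" using g[OF that] by (simp add: a_def)
    have "inverses (1 - a * a) (g' w)"
      unfolding g'_def using inverses_one_minus_square[OF u v] .
    moreover have "(w *\<^sub>C h) ^ 2 ^ Suc k = a * a"
      by (simp add: a_def mult_2 power_add)
    ultimately show ?thesis by simp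
  qed
  moreover have "norm (g' (complex_of_real r * w) - g' w) \<le> L * (1 - r)"
    if "cmod w \<le> 1" "0 \<le> r" "r \<le> 1" for w r
  proof -
    have "g' (complex_of_real r * w) - g' w =
      (1/2) *\<^sub>R ((g (complex_of_real r * w) - g w) + (g (complex_of_real r * (w * z)) - g (w * z)))"
      by (simp add: g'_def algebra_simps)
    also have "norm \<dots> \<le> (1/2) * (L * (1 - r) + L * (1 - r))"
      using gl[of w r] gl[of "w * z" r] that by (simp add: zn norm_triangle_le)
    finally show ?thesis by simp
  qed
  ultimately show ?case by blast
qed

lemma norm_inverse_perturbation:
  fixes x :: "'b::unital_cstar_algebra"
  assumes "u * (1 - x) = 1" "norm x \<le> c" "c < 1"
  shows "norm (u - 1) \<le> c / (1 - c)"
proof -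
  have e: "u - 1 = u * x" using assms(1) by (simp add: algebra_simps)
  then have n: "norm (u - 1) \<le> norm u * c"
    using norm_mult_ineq[of u x] assms(2) by (metis mult_left_mono norm_ge_zero order_trans)
  moreover have "norm u \<le> 1 + norm (u - 1)"
    using norm_triangle_ineq[of 1 "u - 1"] norm_one_le[where 'b = 'b] by simp
  moreover have c0: "0 \<le> c" using assms(2) norm_ge_zero order_trans by blast
  ultimately have "norm (u - 1) \<le> (1 + norm (u - 1)) * c"
    by (meson mult_right_mono order_trans)
  then show ?thesis using assms(3) by (simp add: field_simps)
qed

text \<open>Otherwise \<open>1 - w *\<^sub>C h\<close> is invertible on the whole closed disc:
  inside by \<open>neumann\<close>, at nonreal points of the circle because the spectrum is real.
  For large \<open>n\<close> the inverse of \<open>1 - (w *\<^sub>C h) ^ 2 ^ n\<close> is near 1 at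
  a fixed radius \<open>r < 1\<close>, hence also at \<open>w = 1\<close>, as the Lipschitz constant
  does not depend on \<open>n\<close>; but \<open>h ^ 2 ^ n\<close> keeps norm 1.\<close>

lemma selfadjoint_unit_not_invertible:
  fixes h :: "'b::unital_cstar_algebra"
  assumes h: "star h = h" "norm h = 1"
  shows "(\<forall>c. \<not> inverses (1 - h) c) \<or> (\<forall>c. \<not> inverses (1 + h) c)"
proof (rule ccontr)
  assume "\<not> ?thesis"
  then obtain c1 c2 where c: "inverses (1 - h) c1" "inverses (1 + h) c2" by blast
  have "\<exists>c. inverses (1 - w *\<^sub>C h) c" if w: "cmod w \<le> 1" for w
  proof (cases "cmod w < 1")
    case True
    then show ?thesis by (intro neumann) (simp add: norm_scaleC h)
  next
    case False
    then have w1: "cmod w = 1" "w \<noteq> 0" using w by auto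
    show ?thesis
    proof (cases "Im w = 0")
      case True
      then have "w = 1 \<or> w = - 1"
        using w1 by (auto simp: cmod_def complex_eq_iff)
      then show ?thesis using c by (auto simp: scaleC_minus_left)
    next
      case False
      then have "Im (inverse w) \<noteq> 0" using w1 by simp
      then have "inverse w \<notin> cstar_spectrum h"
        using spectrum_selfadjoint_real h by blast
      then obtain d where "inverses (h - inverse w *\<^sub>C 1) d"
        by (auto simp: cstar_spectrum_alt)
      from inverses_scaleC[OF this, of "- w"] w1 show ?thesis
        by (auto simp: scaleC_diff_right scaleC_scaleC scaleC_minus_left)
    qed
  qed
  then obtain f where f: "\<And>w. cmod w \<le> 1 \<Longrightarrow> inverses (1 - w *\<^sub>C h) (f w)" by metis
  obtain L where L: "L \<ge> 0"
    and lip: "\<And>w v. cmod w \<le> 1 \<Longrightarrow> cmod v \<le> 1 \<Longrightarrow> norm (f w - f v) \<le> L * cmod (w - v)"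
    using resolvent_lipschitz[OF _ f] h by auto
  \<comment> \<open>\<open>r\<close> depends on \<open>L\<close> alone, so \<open>n\<close> can be
    chosen after it. The errors are 1/8 from \<open>r ^ 2 ^ n \<le> 1/9\<close> and 1/8 from the
    Lipschitz bound, in total 1/4.\<close>
  define r where "r = 1 - 1 / (8 * (L + 1))"
  have r: "0 \<le> r" "r < 1" and Lr: "L * (1 - r) \<le> 1 / 8"
    using L by (simp_all add: r_def field_simps)
  obtain n where n: "r ^ n < 1 / 9" using real_arch_pow_inv[of "1/9" r] r by auto
  have "r ^ 2 ^ n \<le> r ^ n" using r by (intro power_decreasing) (auto intro: less_imp_le)
  with n have rn: "r ^ 2 ^ n \<le> 1 / 9" by simp
  obtain g where g: "\<And>w. cmod w \<le> 1 \<Longrightarrow> inverses (1 - (w *\<^sub>C h) ^ 2 ^ n) (g w)"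
    and gl: "\<And>w s. cmod w \<le> 1 \<Longrightarrow> 0 \<le> s \<Longrightarrow> s \<le> 1 \<Longrightarrow>
      norm (g (complex_of_real s * w) - g w) \<le> L * (1 - s)"
    using resolvent_power_lipschitz[OF f lip L, of n] by metis
  define a where "a = h ^ 2 ^ n"
  have a: "norm a = 1" using norm_power_selfadjoint[OF h(1), of n] h by (simp add: a_def)
  have "norm (g (complex_of_real r) - 1) \<le> (1/9) / (1 - 1/9)"
  proof (rule norm_inverse_perturbation)
    show "g (complex_of_real r) * (1 - (complex_of_real r *\<^sub>C h) ^ 2 ^ n) = 1"
      using g[of "complex_of_real r"] r by (simp add: inverses_def)
    show "norm ((complex_of_real r *\<^sub>C h) ^ 2 ^ n) \<le> 1 / 9"
      using rn r a by (simp add: scaleC_power norm_scaleC norm_power a_def)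
  qed simp
  then have gr: "norm (g (complex_of_real r) - 1) \<le> 1 / 8" by simp
  have "norm (g 1 - 1) \<le> 1 / 4"
    using gl[of 1 r] gr r Lr norm_triangle_ineq4[of "g (complex_of_real r) - 1" "g (complex_of_real r) - g 1"]
    by simp
  then have "norm (1 - g 1) \<le> 1 / 4" by (simp add: norm_minus_commute)
  \<comment> \<open>The perturbation bound with the roles exchanged: \<open>1 - a\<close> is now the
    inverse of \<open>g 1\<close>, which gives \<open>norm a \<le> 1/3\<close>.\<close>
  moreover have "(1 - a) * (1 - (1 - g 1)) = 1"
    using g[of 1] by (simp add: inverses_def a_def)
  ultimately have "norm ((1 - a) - 1) \<le> (1/4) / (1 - 1/4)"
    by (intro norm_inverse_perturbation) simp_all
  then show False using a by simp
qed

lemma selfadjoint_norm_in_spectrum: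
  fixes h :: "'b::unital_cstar_algebra"
  assumes h: "star h = h" "h \<noteq> 0"
  shows "complex_of_real (norm h) \<in> cstar_spectrum h \<or> - complex_of_real (norm h) \<in> cstar_spectrum h"
proof (rule ccontr)
  assume "\<not> ?thesis"
  then obtain c d where c: "inverses (h - complex_of_real (norm h) *\<^sub>C 1) c"
    "inverses (h + complex_of_real (norm h) *\<^sub>C 1) d"
    by (auto simp: cstar_spectrum_alt scaleC_minus_left)
  define e where "e = inverse (norm h)"
  have e: "e * norm h = 1" using h by (simp add: e_def)
  then have e0: "complex_of_real e \<noteq> 0" by auto
  define k where "k = e *\<^sub>R h"
  have k: "star k = k" "norm k = 1" using h e by (simp_all add: k_def star_scaleR e_def)
  have "complex_of_real e *\<^sub>C (h + complex_of_real (norm h) *\<^sub>C 1) = k + 1"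
    by (simp add: scaleC_add_right scaleC_of_real k_def e)
  then have "\<exists>d. inverses (1 + k) d"
    using inverses_scaleC[OF c(2) e0] by (auto simp: add.commute)
  moreover have "complex_of_real e *\<^sub>C (h - complex_of_real (norm h) *\<^sub>C 1) = - (1 - k)"
    by (simp add: scaleC_diff_right scaleC_of_real k_def e)
  then have "\<exists>c. inverses (1 - k) c"
    using inverses_minus[OF inverses_scaleC[OF c(1) e0]] by auto
  ultimately show False using selfadjoint_unit_not_invertible[OF k] by blast
qed

section \<open>Positive elements\<close>

lemma cstar_positive_selfadjoint: "cstar_positive a \<Longrightarrow> star a = a"
  by (simp add: cstar_positive_def)

text \<open>With its converse \<open>cstar_positiveI_norm\<close> this replaces the spectral
  condition by a convex one. If \<open>t *\<^sub>R 1 - a\<close> had norm \<open>s > t\<close>, the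
  spectrum of \<open>a\<close> would contain \<open>t - s\<close>, which is negative, or
  \<open>t + s\<close>, which exceeds \<open>norm a\<close>.\<close>

lemma cstar_positive_norm_diff_le:
  fixes a :: "'b::unital_cstar_algebra"
  assumes a: "cstar_positive a" and t: "norm a \<le> t"
  shows "norm (t *\<^sub>R 1 - a) \<le> t"
proof (rule ccontr)
  define c where "c = t *\<^sub>R 1 - a"
  assume "\<not> norm (t *\<^sub>R 1 - a) \<le> t"
  then have ct: "norm c > t" by (simp add: c_def)
  have t0: "0 \<le> t" using t norm_ge_zero order_trans by blast
  have "star c = c" using a by (simp add: c_def star_diff star_scaleR cstar_positive_def)
  moreover have "c \<noteq> 0" using ct t0 by auto
  ultimately obtain s where s: "s \<in> {norm c, - norm c}" "complex_of_real s \<in> cstar_spectrum c"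
    using selfadjoint_norm_in_spectrum[of c] by (metis insert_iff of_real_minus)
  have ac: "a = - c + complex_of_real t *\<^sub>C 1" by (simp add: c_def scaleC_of_real)
  have sp: "complex_of_real (t - s) \<in> cstar_spectrum a"
    using spectrum_shift[OF spectrum_minus[OF s(2)], of "complex_of_real t"] by (simp add: ac)
  then have "complex_of_real (t - s) \<in> \<real>\<^sub>\<ge>\<^sub>0" using a unfolding cstar_positive_def by blast
  then have "0 \<le> t - s" by (simp only: nonneg_Reals_of_real_iff)
  moreover have "\<bar>t - s\<bar> \<le> norm a"
    using spectrum_norm_le[OF sp] by (simp only: norm_of_real)
  ultimately show False using s(1) ct t t0 by auto
qed

lemma cstar_positiveI_norm:
  fixes a :: "'b::unital_cstar_algebra"
  assumes a: "star a = a" and t: "norm (t *\<^sub>R 1 - a) \<le> t"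
  shows "cstar_positive a"
  unfolding cstar_positive_def
proof (intro conjI subsetI a)
  fix z assume z: "z \<in> cstar_spectrum a"
  have "Im z = 0" using spectrum_selfadjoint_real[OF a z] .
  moreover have "- z + complex_of_real t \<in> cstar_spectrum (- a + complex_of_real t *\<^sub>C 1)"
    using spectrum_shift[OF spectrum_minus[OF z]] .
  then have "cmod (complex_of_real t - z) \<le> t"
    using spectrum_norm_le t by (fastforce simp: scaleC_of_real)
  then have "\<bar>t - Re z\<bar> \<le> t" using abs_Re_le_cmod[of "complex_of_real t - z"] by simp
  then have "0 \<le> Re z" by linarith
  ultimately show "z \<in> \<real>\<^sub>\<ge>\<^sub>0" by (simp add: complex_nonneg_Reals_iff)
qed

lemma cstar_positive_zero [simp]: "cstar_positive (0::'b::unital_cstar_algebra)"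
  by (rule cstar_positiveI_norm[of _ 0]) simp_all

lemma cstar_positive_add:
  fixes a b :: "'b::unital_cstar_algebra"
  assumes a: "cstar_positive a" and b: "cstar_positive b"
  shows "cstar_positive (a + b)"
proof (rule cstar_positiveI_norm)
  show "star (a + b) = a + b" using a b by (simp add: cstar_positive_def star_add)
  have "(norm a + norm b) *\<^sub>R 1 - (a + b) = (norm a *\<^sub>R 1 - a) + (norm b *\<^sub>R 1 - b)"
    by (simp add: algebra_simps)
  also have "norm \<dots> \<le> norm a + norm b"
    using cstar_positive_norm_diff_le[OF a order_refl] cstar_positive_norm_diff_le[OF b order_refl]
    by (rule norm_triangle_mono)
  finally show "norm ((norm a + norm b) *\<^sub>R 1 - (a + b)) \<le> norm a + norm b" .
qed

lemma cstar_positive_sum: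
  fixes f :: "'i \<Rightarrow> 'b::unital_cstar_algebra"
  shows "(\<And>i. i \<in> A \<Longrightarrow> cstar_positive (f i)) \<Longrightarrow> cstar_positive (\<Sum>i\<in>A. f i)"
  by (induction A rule: infinite_finite_induct) (simp_all add: cstar_positive_add)

lemma cstar_positive_scaleR:
  fixes a :: "'b::unital_cstar_algebra"
  assumes a: "cstar_positive a" and r: "0 \<le> r"
  shows "cstar_positive (r *\<^sub>R a)"
proof (rule cstar_positiveI_norm)
  show "star (r *\<^sub>R a) = r *\<^sub>R a" using a by (simp add: cstar_positive_def star_scaleR)
  have "(r * norm a) *\<^sub>R 1 - r *\<^sub>R a = r *\<^sub>R (norm a *\<^sub>R 1 - a)" by (simp add: algebra_simps)
  then show "norm ((r * norm a) *\<^sub>R 1 - r *\<^sub>R a) \<le> r * norm a"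
    using cstar_positive_norm_diff_le[OF a order_refl] r by (simp add: mult_left_mono)
qed

lemma cstar_positive_norm_in_spectrum:
  fixes a :: "'b::unital_cstar_algebra"
  assumes a: "cstar_positive a" "a \<noteq> 0"
  shows "complex_of_real (norm a) \<in> cstar_spectrum a"
proof -
  have "- complex_of_real (norm a) \<notin> cstar_spectrum a"
    using a unfolding cstar_positive_def
    by (metis complex_nonneg_Reals_iff neg_0_le_iff_le norm_le_zero_iff of_real_minus Re_complex_of_real subsetD)
  then show ?thesis using selfadjoint_norm_in_spectrum[of a] a by (auto simp: cstar_positive_def)
qed

lemma cstar_positive_antisym:
  fixes a :: "'b::unital_cstar_algebra"
  assumes a: "cstar_positive a" "cstar_positive (- a)"
  shows "a = 0"
proof (rule ccontr)
  assume "a \<noteq> 0"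
  then have "- complex_of_real (norm a) \<in> cstar_spectrum (- a)"
    using spectrum_minus[OF cstar_positive_norm_in_spectrum] a by blast
  then have "- complex_of_real (norm a) \<in> \<real>\<^sub>\<ge>\<^sub>0" using a(2) unfolding cstar_positive_def by blast
  then show False using \<open>a \<noteq> 0\<close> by (simp add: complex_nonneg_Reals_iff)
qed

lemma cstar_positive_norm_diff:
  fixes a :: "'b::unital_cstar_algebra"
  assumes "cstar_positive a" "norm a \<le> t"
  shows "cstar_positive (t *\<^sub>R 1 - a)"
proof (rule cstar_positiveI_norm)
  show "star (t *\<^sub>R 1 - a) = t *\<^sub>R 1 - a"
    using assms by (simp add: star_diff star_scaleR cstar_positive_def)
  show "norm (t *\<^sub>R 1 - (t *\<^sub>R 1 - a)) \<le> t" using assms by simp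
qed

text \<open>\<open>norm b *\<^sub>R 1 - a\<close> is positive as the sum of \<open>b - a\<close> and
  \<open>norm b *\<^sub>R 1 - b\<close>, and for \<open>a \<noteq> 0\<close> its spectrum contains
  \<open>norm b - norm a\<close>.\<close>

lemma cstar_positive_norm_mono:
  fixes a b :: "'b::unital_cstar_algebra"
  assumes a: "cstar_positive a" and ab: "cstar_positive (b - a)"
  shows "norm a \<le> norm b"
proof (cases "a = 0")
  case False
  have "cstar_positive b" using cstar_positive_add[OF a ab] by simp
  from cstar_positive_add[OF ab cstar_positive_norm_diff[OF this order_refl]]
  have p: "cstar_positive (norm b *\<^sub>R 1 - a)" by (simp add: algebra_simps)
  have "- complex_of_real (norm a) + complex_of_real (norm b) \<in>
      cstar_spectrum (- a + complex_of_real (norm b) *\<^sub>C 1)"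
    by (intro spectrum_shift spectrum_minus cstar_positive_norm_in_spectrum a False)
  then have "complex_of_real (norm b - norm a) \<in> cstar_spectrum (norm b *\<^sub>R 1 - a)"
    by (simp add: scaleC_of_real)
  then have "complex_of_real (norm b - norm a) \<in> \<real>\<^sub>\<ge>\<^sub>0" using p unfolding cstar_positive_def by blast
  then show ?thesis by (simp only: nonneg_Reals_of_real_iff)
qed simp

text \<open>If \<open>w * w = z\<close>, then \<open>h * h - z\<close> factors as
  \<open>(h - w) * (h + w)\<close>, so a nonreal \<open>w\<close> keeps \<open>z\<close> out of the
  spectrum, while a real \<open>w\<close> makes \<open>z\<close> nonnegative.\<close>

lemma cstar_positive_square:
  fixes h :: "'b::unital_cstar_algebra"
  assumes h: "star h = h"
  shows "cstar_positive (h * h)"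
  unfolding cstar_positive_def
proof (intro conjI subsetI)
  show hh: "star (h * h) = h * h" using h by (simp add: star_mult)
  fix z assume z: "z \<in> cstar_spectrum (h * h)"
  define w where "w = csqrt z"
  have ww: "w * w = z" by (simp add: w_def flip: power2_eq_square)
  have "Im w = 0"
  proof (rule ccontr)
    assume "Im w \<noteq> 0"
    then have "w \<notin> cstar_spectrum h" "- w \<notin> cstar_spectrum h"
      using spectrum_selfadjoint_real[OF h, of w] spectrum_selfadjoint_real[OF h, of "- w"] by auto
    then obtain c d where "inverses (h - w *\<^sub>C 1) c" "inverses (h + w *\<^sub>C 1) d"
      by (auto simp: cstar_spectrum_alt scaleC_minus_left)
    from inverses_mult[OF this]
    have "inverses (h * h - z *\<^sub>C 1) (d * c)"
      by (simp add: algebra_simps mult_scaleC_left mult_scaleC_right scaleC_scaleC scaleC_diff_right flip: ww)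
    then show False using z by (auto simp: cstar_spectrum_alt)
  qed
  then show "z \<in> \<real>\<^sub>\<ge>\<^sub>0" using ww by (auto simp: complex_nonneg_Reals_iff)
qed

lemma spectrum_mult_commute:
  fixes x y :: "'b::unital_cstar_algebra"
  assumes z: "z \<in> cstar_spectrum (x * y)" "z \<noteq> 0"
  shows "z \<in> cstar_spectrum (y * x)"
proof (rule ccontr)
  assume "z \<notin> cstar_spectrum (y * x)"
  then obtain c where c: "c * (y * x - z *\<^sub>C 1) = 1" "(y * x - z *\<^sub>C 1) * c = 1"
    by (auto simp: cstar_spectrum_alt inverses_def)
  have c1: "c * y * x = 1 + z *\<^sub>C c" "y * x * c = 1 + z *\<^sub>C c"
    using c by (simp_all add: algebra_simps mult_scaleC_left mult_scaleC_right)
  \<comment> \<open>Jacobson's formula: expand the inverse of \<open>x * y - z\<close> formally as a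
    geometric series and collect the powers of \<open>y * x\<close> into \<open>c\<close>.\<close>
  define d where "d = inverse z *\<^sub>C (x * c * y - 1)"
  have "(x * c * y - 1) * (x * y - z *\<^sub>C 1) = x * (c * y * x) * y - x * y - z *\<^sub>C (x * c * y) + z *\<^sub>C 1"
    by (simp add: algebra_simps mult_scaleC_right scaleC_diff_right)
  also have "\<dots> = z *\<^sub>C 1"
    by (simp only: c1) (simp add: algebra_simps mult_scaleC_left mult_scaleC_right scaleC_diff_right)
  finally have 1: "d * (x * y - z *\<^sub>C 1) = 1"
    using z(2) by (simp add: d_def mult_scaleC_left scaleC_scaleC)
  have "(x * y - z *\<^sub>C 1) * (x * c * y - 1) = x * (y * x * c) * y - x * y - z *\<^sub>C (x * c * y) + z *\<^sub>C 1"
    by (simp add: algebra_simps mult_scaleC_left scaleC_diff_right)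
  also have "\<dots> = z *\<^sub>C 1"
    by (simp only: c1) (simp add: algebra_simps mult_scaleC_left mult_scaleC_right scaleC_diff_right)
  finally have 2: "(x * y - z *\<^sub>C 1) * d = 1"
    using z(2) by (simp add: d_def mult_scaleC_right scaleC_scaleC)
  show False using z(1) 1 2 by (auto simp: cstar_spectrum_alt inverses_def)
qed

section \<open>Banach modules and square roots\<close>

context left_module
begin

lemma act_zero_right [simp]: "act a 0 = 0"
  using act_add_right[of a 0 0] by simp

lemma act_zero_left [simp]: "act 0 x = 0"
  using act_add_left[of 0 0 x] by simp

lemma act_minus_right: "act a (- x) = - act a x"
  using act_add_right[of a x "- x"] by (simp add: eq_neg_iff_add_eq_0 add.commute)

lemma act_minus_left: "act (- a) x = - act a x"
  using act_add_left[of a "- a" x] by (simp add: eq_neg_iff_add_eq_0 add.commute)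

lemma act_diff_right: "act a (x - y) = act a x - act a y"
  using act_add_right[of a x "- y"] by (simp add: act_minus_right)

lemma act_sum_right: "act a (\<Sum>i\<in>A. f i) = (\<Sum>i\<in>A. act a (f i))"
  by (induction A rule: infinite_finite_induct) (simp_all add: act_add_right)

definition linear_map :: "('m \<Rightarrow> 'm) \<Rightarrow> bool" where
  "linear_map A \<longleftrightarrow> (\<forall>x y. A (x + y) = A x + A y) \<and> (\<forall>a x. A (act a x) = act a (A x))"

lemma linear_mapD:
  assumes "linear_map A"
  shows "A (x + y) = A x + A y" "A (act a x) = act a (A x)" "A 0 = 0"
    "A (- x) = - A x" "A (x - y) = A x - A y"
proof -
  show add: "A (x + y) = A x + A y" for x y using assms by (simp add: linear_map_def)
  show "A (act a x) = act a (A x)" using assms by (simp add: linear_map_def)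
  show z: "A 0 = 0" using add[of 0 0] by simp
  show m: "A (- x) = - A x" for x
    using add[of x "- x"] z by (simp add: eq_neg_iff_add_eq_0 add.commute)
  show "A (x - y) = A x - A y" using add[of x "- y"] by (simp add: m)
qed

end

text \<open>Modules of this kind include both the algebra acting on itself and Hilbert modules, so the
  square root construction below applies to elements of the algebra and to module operators.\<close>

locale banach_module = left_module act
  for act :: "'b::unital_cstar_algebra \<Rightarrow> 'm::ab_group_add \<Rightarrow> 'm" +
  fixes N :: "'m \<Rightarrow> real"
  assumes N_add: "N (x + y) \<le> N x + N y"
    and N_act: "N (act a x) \<le> norm a * N x"
    and N_eq_0: "N x = 0 \<Longrightarrow> x = 0"
    and N_complete: "(\<forall>e>0. \<exists>k. \<forall>m\<ge>k. \<forall>n\<ge>k. N (X m - X n) < e) \<Longrightarrow>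
      \<exists>x. (\<lambda>n. N (X n - x)) \<longlonglongrightarrow> 0"
begin

lemma N_zero [simp]: "N 0 = 0"
  using N_act[of 0 0] N_add[of 0 0] by simp

lemma N_nonneg [simp]: "0 \<le> N x"
proof -
  have "N (- x) \<le> norm (1::'b) * N x"
    using N_act[of "- 1" x] by (simp add: act_minus_left act_one)
  then have "0 \<le> (1 + norm (1::'b)) * N x"
    using N_add[of x "- x"] by (simp add: algebra_simps)
  then show ?thesis
    by (simp add: zero_le_mult_iff) (smt (verit) norm_ge_zero)
qed

lemma N_minus_le: "N (- x) \<le> N x"
proof -
  have "N (- x) \<le> norm (1::'b) * N x"
    using N_act[of "- 1" x] by (simp add: act_minus_left act_one)
  also have "\<dots> \<le> N x"
    using norm_one_le by (rule mult_left_le_one_le[OF N_nonneg norm_ge_zero])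
  finally show ?thesis .
qed

lemma N_minus: "N (- x) = N x"
  using N_minus_le[of x] N_minus_le[of "- x"] by simp

lemma N_commute: "N (x - y) = N (y - x)"
  using N_minus[of "x - y"] by simp

lemma N_triangle: "N (x - z) \<le> N (x - y) + N (y - z)"
  using N_add[of "x - y" "y - z"] by simp

lemma N_scaleR: "N (act (r *\<^sub>R 1) x) \<le> \<bar>r\<bar> * N x"
  by (meson N_act N_nonneg mult_right_mono norm_scaleR_one_le order_trans)

lemma N_tendsto_zero:
  assumes "\<And>n. N (X n) \<le> g n" "g \<longlonglongrightarrow> 0"
  shows "(\<lambda>n. N (X n)) \<longlonglongrightarrow> 0"
  by (rule tendsto_sandwich[OF _ _ tendsto_const assms(2)]) (simp_all add: assms(1))

lemma N_limit_unique:
  assumes "(\<lambda>n. N (X n - x)) \<longlonglongrightarrow> 0" "(\<lambda>n. N (X n - y)) \<longlonglongrightarrow> 0"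
  shows "x = y"
proof -
  have "(\<lambda>n. N (X n - x) + N (X n - y)) \<longlonglongrightarrow> 0" using tendsto_add[OF assms] by simp
  moreover have "N (x - y) \<le> N (X n - x) + N (X n - y)" for n
    using N_triangle[of x y "X n"] by (simp add: N_commute)
  ultimately have "N (x - y) \<le> 0" by (intro LIMSEQ_le_const) auto
  then have "N (x - y) = 0" using N_nonneg[of "x - y"] by linarith
  then have "x - y = 0" by (rule N_eq_0)
  then show ?thesis by simp
qed

text \<open>The norm is a parameter and not a type class operation, so the fixed point theorem and
  Baire category are obtained from the set-based metric spaces.\<close>

sublocale N_metric: Metric_space UNIV "\<lambda>x y. N (x - y)"
proof
  show "N (x - y) = 0 \<longleftrightarrow> x = y" for x y using N_eq_0[of "x - y"] by auto
qed (simp_all add: N_commute N_triangle)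

lemma N_mcomplete: "N_metric.mcomplete"
proof -
  have "\<exists>x. limitin N_metric.mtopology X x sequentially" if X: "N_metric.MCauchy X" for X
  proof -
    have "\<forall>e>0. \<exists>k. \<forall>m\<ge>k. \<forall>n\<ge>k. N (X m - X n) < e"
    proof (intro allI impI)
      fix e :: real assume "0 < e"
      then obtain k where "\<forall>m n. k \<le> m \<longrightarrow> k \<le> n \<longrightarrow> N (X m - X n) < e"
        using X unfolding N_metric.MCauchy_def by meson
      then show "\<exists>k. \<forall>m\<ge>k. \<forall>n\<ge>k. N (X m - X n) < e" by blast
    qed
    then obtain x where "(\<lambda>n. N (X n - x)) \<longlonglongrightarrow> 0"
      using N_complete by blast
    then have "limitin N_metric.mtopology X x sequentially"
      unfolding N_metric.limitin_metric by (simp add: tendsto_iff)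
    then show ?thesis ..
  qed
  then show ?thesis by (simp add: N_metric.mcomplete_def)
qed

lemma contraction_solve:
  assumes A: "linear_map A" "\<And>x. N (A x) \<le> k * N x" and k: "k < 1"
  shows "\<exists>x. x = y + A x"
proof -
  have "N ((y + A u) - (y + A v)) \<le> k * N (u - v)" for u v
    using A(2)[of "u - v"] by (simp add: linear_mapD[OF A(1)])
  then obtain x where "y + A x = x"
    using N_metric.Banach_fixedpoint_thm[OF N_mcomplete, of "\<lambda>x. y + A x" k] k by auto
  then show ?thesis by metis
qed

end

section \<open>Square roots by a majorized iteration\<close>

text \<open>The operator iteration \<open>Y\<close> below, run with the number 1 in place of
  \<open>T\<close>.\<close>

fun sqrt_bound :: "nat \<Rightarrow> real" where
  "sqrt_bound 0 = 0"
| "sqrt_bound (Suc n) = (1 + sqrt_bound n * sqrt_bound n) / 2"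

lemma sqrt_bound: "0 \<le> sqrt_bound n \<and> sqrt_bound n \<le> 1"
proof (induction n)
  case (Suc n)
  then have "sqrt_bound n * sqrt_bound n \<le> 1" by (simp add: mult_le_one)
  then show ?case by simp
qed simp

lemma sqrt_bound_mono: "mono sqrt_bound"
proof (rule mono_iff_le_Suc[THEN iffD2], intro allI)
  fix n
  have "2 * (sqrt_bound (Suc n) - sqrt_bound n) = (1 - sqrt_bound n) * (1 - sqrt_bound n)"
    by (simp add: algebra_simps)
  then have "0 \<le> 2 * (sqrt_bound (Suc n) - sqrt_bound n)"
    by (simp only: zero_le_square)
  then show "sqrt_bound n \<le> sqrt_bound (Suc n)"
    by (simp del: sqrt_bound.simps)
qed

definition sqrt_bound_lim :: real where "sqrt_bound_lim = lim sqrt_bound"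

lemma sqrt_bound_LIMSEQ: "sqrt_bound \<longlonglongrightarrow> sqrt_bound_lim"
proof -
  have "Bseq sqrt_bound" using sqrt_bound by (intro BseqI'[of _ 1]) auto
  then show ?thesis
    unfolding sqrt_bound_lim_def
    by (intro Bseq_mono_convergent[THEN convergent_LIMSEQ_iff[THEN iffD1]])
      (use sqrt_bound_mono in \<open>auto simp: mono_def\<close>)
qed

lemma sqrt_bound_le_lim: "sqrt_bound n \<le> sqrt_bound_lim"
  using sqrt_bound_LIMSEQ sqrt_bound_mono
  by (intro incseq_le)

lemma sqrt_bound_lim: "0 \<le> sqrt_bound_lim" "sqrt_bound_lim \<le> 1"
proof -
  show "0 \<le> sqrt_bound_lim" using sqrt_bound_le_lim[of 0] by simp
  show "sqrt_bound_lim \<le> 1"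
    using sqrt_bound_LIMSEQ sqrt_bound by (intro LIMSEQ_le_const2) auto
qed

text \<open>The fixed point \<open>Y = (T + Y\<^sup>2) / 2\<close> satisfies \<open>(1 - Y)\<^sup>2 = 1 - T\<close>. The iteration for the scalar \<open>1\<close>
  majorizes the one for \<open>T\<close>, which gives convergence even when \<open>\<parallel>T\<parallel> = 1\<close>.\<close>

locale module_contraction = banach_module act N
  for act :: "'b::unital_cstar_algebra \<Rightarrow> 'm::ab_group_add \<Rightarrow> 'm" and N +
  fixes T :: "'m \<Rightarrow> 'm"
  assumes T_linear: "linear_map T"
    and T_contraction: "N (T x) \<le> N x"
begin

fun Y :: "nat \<Rightarrow> 'm \<Rightarrow> 'm" where
  "Y 0 x = 0"
| "Y (Suc n) x = act ((1/2) *\<^sub>R 1) (T x + Y n (Y n x))"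

lemma Y_linear: "linear_map (Y n)"
proof (induction n)
  case 0
  then show ?case by (simp add: linear_map_def)
next
  case (Suc n)
  have "act (r *\<^sub>R 1) (act a x) = act a (act (r *\<^sub>R 1) x)" for r a x
    by (simp add: act_act)
  then show ?case
    unfolding linear_map_def
    by (simp add: linear_mapD[OF T_linear] linear_mapD[OF Suc] act_add_right add_ac)
qed

lemma N_half: "N (act ((1/2) *\<^sub>R 1) x) \<le> N x / 2"
  using N_scaleR[of "1/2" x] by simp

lemma half_double: "act ((1/2) *\<^sub>R 1) x + act ((1/2) *\<^sub>R 1) x = x"
  by (simp add: act_one flip: act_add_left scaleR_add_left)

lemma Y_norm: "N (Y n x) \<le> sqrt_bound n * N x"
proof (induction n arbitrary: x)
  case (Suc n)
  have "N (Y n (Y n x)) \<le> sqrt_bound n * (sqrt_bound n * N x)"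
    using Suc[of "Y n x"] Suc[of x] sqrt_bound[of n] by (meson mult_left_mono order_trans)
  then have "N (T x + Y n (Y n x)) \<le> N x + sqrt_bound n * (sqrt_bound n * N x)"
    using N_add[of "T x" "Y n (Y n x)"] T_contraction[of x] by linarith
  then show ?case using N_half[of "T x + Y n (Y n x)"] by (simp add: field_simps)
qed simp

text \<open>For \<open>y = Y n\<close> and \<open>z = Y (Suc n)\<close> write
  \<open>z z - y y = z (z - y) + (z - y) y\<close>. The resulting bound
  \<open>b (b - a) + (b - a) a\<close> is exactly the scalar difference
  \<open>b b - a a\<close>.\<close>

lemma Y_step: "N (Y (Suc n) x - Y n x) \<le> (sqrt_bound (Suc n) - sqrt_bound n) * N x"
proof (induction n arbitrary: x)
  case 0
  show ?case using N_half[of "T x"] T_contraction[of x] by simp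
next
  case (Suc n)
  let ?a = "sqrt_bound n" and ?b = "sqrt_bound (Suc n)" and ?y = "Y n" and ?z = "Y (Suc n)"
  have ab: "0 \<le> ?b - ?a" using sqrt_bound_mono by (simp add: mono_iff_le_Suc del: sqrt_bound.simps)
  have "?z (?z x) - ?y (?y x) = ?z (?z x - ?y x) + (?z (?y x) - ?y (?y x))"
    by (simp add: linear_mapD[OF Y_linear] del: Y.simps)
  then have "N (?z (?z x) - ?y (?y x)) \<le> N (?z (?z x - ?y x)) + N (?z (?y x) - ?y (?y x))"
    using N_add by metis
  also have "\<dots> \<le> ?b * ((?b - ?a) * N x) + (?b - ?a) * (?a * N x)"
  proof (rule add_mono)
    show "N (?z (?z x - ?y x)) \<le> ?b * ((?b - ?a) * N x)"
      using Y_norm[of "Suc n" "?z x - ?y x"] Suc[of x] sqrt_bound[of "Suc n"]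
      by (meson mult_left_mono order_trans)
    show "N (?z (?y x) - ?y (?y x)) \<le> (?b - ?a) * (?a * N x)"
      using Suc[of "?y x"] Y_norm[of n x] ab by (meson mult_left_mono order_trans)
  qed
  also have "\<dots> = (?b * ?b - ?a * ?a) * N x" by (simp add: algebra_simps del: sqrt_bound.simps)
  finally have "N (?z (?z x) - ?y (?y x)) \<le> (?b * ?b - ?a * ?a) * N x" .
  moreover have "Y (Suc (Suc n)) x - ?z x = act ((1/2) *\<^sub>R 1) (?z (?z x) - ?y (?y x))"
    by (simp only: Y.simps flip: act_diff_right) simp
  ultimately have "N (Y (Suc (Suc n)) x - ?z x) \<le> (?b * ?b - ?a * ?a) / 2 * N x"
    using N_half[of "?z (?z x) - ?y (?y x)"] by simp
  moreover have "sqrt_bound (Suc (Suc n)) - ?b = (?b * ?b - ?a * ?a) / 2"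
    by (simp only: sqrt_bound.simps(2)[of "Suc n"] sqrt_bound.simps(2)[of n])
      (simp add: field_simps)
  ultimately show ?case by (simp only:)
qed

lemma Y_diff: "m \<ge> n \<Longrightarrow> N (Y m x - Y n x) \<le> (sqrt_bound m - sqrt_bound n) * N x"
proof (induction m rule: dec_induct)
  case (step m)
  then show ?case
    using N_triangle[of "Y (Suc m) x" "Y n x" "Y m x"] Y_step[of m x]
    by (simp add: algebra_simps del: Y.simps sqrt_bound.simps)
qed simp

lemma Y_converges: "\<exists>y. (\<lambda>n. N (Y n x - y)) \<longlonglongrightarrow> 0"
proof (rule N_complete, intro allI impI)
  fix e :: real assume e: "0 < e"
  have "(\<lambda>n. (sqrt_bound_lim - sqrt_bound n) * N x) \<longlonglongrightarrow> (sqrt_bound_lim - sqrt_bound_lim) * N x"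
    by (intro tendsto_intros sqrt_bound_LIMSEQ)
  then have "eventually (\<lambda>n. (sqrt_bound_lim - sqrt_bound n) * N x < e) sequentially"
    using e by (intro order_tendstoD(2)) auto
  then obtain k where k: "\<And>n. n \<ge> k \<Longrightarrow> (sqrt_bound_lim - sqrt_bound n) * N x < e"
    by (auto simp: eventually_sequentially)
  have lt: "N (Y m x - Y n x) < e" if "m \<ge> n" "n \<ge> k" for m n
  proof -
    have "N (Y m x - Y n x) \<le> (sqrt_bound_lim - sqrt_bound n) * N x"
      using Y_diff[OF that(1), of x] sqrt_bound_le_lim[of m]
      by (meson N_nonneg diff_right_mono mult_right_mono order_trans)
    then show ?thesis using k[OF that(2)] by simp
  qed
  have "N (Y m x - Y n x) < e" if "m \<ge> k" "n \<ge> k" for m n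
    using lt[of n m] lt[of m n] that by (metis N_commute nle_le)
  then show "\<exists>k. \<forall>m\<ge>k. \<forall>n\<ge>k. N (Y m x - Y n x) < e" by blast
qed

definition L :: "'m \<Rightarrow> 'm" where "L x = (SOME y. (\<lambda>n. N (Y n x - y)) \<longlonglongrightarrow> 0)"

lemma Y_lim: "(\<lambda>n. N (Y n x - L x)) \<longlonglongrightarrow> 0"
  unfolding L_def by (rule someI_ex[OF Y_converges])

lemma L_eqI: "(\<lambda>n. N (Y n x - y)) \<longlonglongrightarrow> 0 \<Longrightarrow> L x = y"
  by (rule N_limit_unique[OF Y_lim])

lemma Y_L_diff: "N (Y n x - L x) \<le> (sqrt_bound_lim - sqrt_bound n) * N x"
proof (rule LIMSEQ_le_const2)
  show "(\<lambda>m. N (Y n x - L x) - N (Y m x - L x)) \<longlonglongrightarrow> N (Y n x - L x)"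
    using tendsto_diff[OF tendsto_const Y_lim] by simp
  have "N (Y n x - L x) - N (Y m x - L x) \<le> (sqrt_bound_lim - sqrt_bound n) * N x" if "m \<ge> n" for m
  proof -
    have "N (Y n x - L x) - N (Y m x - L x) \<le> N (Y m x - Y n x)"
      using N_triangle[of "Y n x" "L x" "Y m x"] by (simp add: N_commute[of "Y n x"])
    also have "\<dots> \<le> (sqrt_bound m - sqrt_bound n) * N x" by (rule Y_diff[OF that])
    also have "\<dots> \<le> (sqrt_bound_lim - sqrt_bound n) * N x"
      using sqrt_bound_le_lim[of m] by (intro mult_right_mono) auto
    finally show ?thesis .
  qed
  then show "\<exists>k. \<forall>m\<ge>k. N (Y n x - L x) - N (Y m x - L x) \<le> (sqrt_bound_lim - sqrt_bound n) * N x"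
    by blast
qed

lemma L_linear: "linear_map L"
  unfolding linear_map_def
proof (intro conjI allI)
  show "L (x + y) = L x + L y" for x y
  proof (rule L_eqI)
    have "N (Y n (x + y) - (L x + L y)) \<le> N (Y n x - L x) + N (Y n y - L y)" for n
      using N_add[of "Y n x - L x" "Y n y - L y"]
      by (simp add: linear_mapD[OF Y_linear] algebra_simps del: Y.simps)
    moreover have "(\<lambda>n. N (Y n x - L x) + N (Y n y - L y)) \<longlonglongrightarrow> 0"
      using tendsto_add[OF Y_lim Y_lim] by simp
    ultimately show "(\<lambda>n. N (Y n (x + y) - (L x + L y))) \<longlonglongrightarrow> 0"
      by (rule N_tendsto_zero)
  qed
  show "L (act a x) = act a (L x)" for a x
  proof (rule L_eqI)
    have "N (Y n (act a x) - act a (L x)) \<le> norm a * N (Y n x - L x)" for n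
      using N_act[of a "Y n x - L x"]
      by (simp add: linear_mapD[OF Y_linear] act_diff_right del: Y.simps)
    moreover have "(\<lambda>n. norm a * N (Y n x - L x)) \<longlonglongrightarrow> 0"
      using tendsto_mult[OF tendsto_const Y_lim] by simp
    ultimately show "(\<lambda>n. N (Y n (act a x) - act a (L x))) \<longlonglongrightarrow> 0"
      by (rule N_tendsto_zero)
  qed
qed

lemma L_norm: "N (L x) \<le> N x"
proof -
  have "N (L x) \<le> sqrt_bound_lim * N x" using Y_L_diff[of 0 x] by (simp add: N_minus)
  also have "\<dots> \<le> 1 * N x" using sqrt_bound_lim(2) by (rule mult_right_mono) simp
  finally show ?thesis by simp
qed

text \<open>The limit passes through the square by comparing \<open>Y n (Y n x)\<close> with
  \<open>Y n (L x)\<close>, since every \<open>Y n\<close> is nonexpansive.\<close>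

lemma L_fixpoint: "L x + L x = T x + L (L x)"
proof -
  have "L x = act ((1/2) *\<^sub>R 1) (T x + L (L x))"
  proof (rule N_limit_unique)
    show "(\<lambda>n. N (Y (Suc n) x - L x)) \<longlonglongrightarrow> 0" by (rule LIMSEQ_Suc[OF Y_lim])
    have "N (Y (Suc n) x - act ((1/2) *\<^sub>R 1) (T x + L (L x))) \<le> N (Y n x - L x) + N (Y n (L x) - L (L x))"
      for n
    proof -
      have "Y (Suc n) x - act ((1/2) *\<^sub>R 1) (T x + L (L x)) = act ((1/2) *\<^sub>R 1) (Y n (Y n x) - L (L x))"
        by (simp flip: act_diff_right)
      then have "N (Y (Suc n) x - act ((1/2) *\<^sub>R 1) (T x + L (L x))) \<le> N (Y n (Y n x) - L (L x)) / 2"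
        by (simp only: N_half)
      also have "\<dots> \<le> N (Y n (Y n x) - L (L x))" by simp
      also have "\<dots> \<le> N (Y n (Y n x - L x)) + N (Y n (L x) - L (L x))"
        using N_triangle[of "Y n (Y n x)" "L (L x)" "Y n (L x)"] by (simp add: linear_mapD[OF Y_linear])
      also have "N (Y n (Y n x - L x)) \<le> N (Y n x - L x)"
        using Y_norm[of n "Y n x - L x"] sqrt_bound[of n] mult_right_mono[of "sqrt_bound n" 1 "N (Y n x - L x)"]
        by simp
      finally show ?thesis by simp
    qed
    moreover have "(\<lambda>n. N (Y n x - L x) + N (Y n (L x) - L (L x))) \<longlonglongrightarrow> 0"
      using tendsto_add[OF Y_lim Y_lim] by simp
    ultimately show "(\<lambda>n. N (Y (Suc n) x - act ((1/2) *\<^sub>R 1) (T x + L (L x)))) \<longlonglongrightarrow> 0"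
      by (rule N_tendsto_zero)
  qed
  then show ?thesis using half_double by metis
qed

lemma square_root: "(x - L x) - L (x - L x) = x - T x"
proof -
  have "(x - L x) - L (x - L x) = x - (L x + L x) + L (L x)"
    by (simp add: linear_mapD[OF L_linear] algebra_simps)
  then show ?thesis by (simp add: L_fixpoint)
qed

text \<open>\<open>A\<close> commutes with every iterate by induction and, being bounded, with the
  limit.\<close>

lemma L_commute:
  assumes A: "\<And>x y. A (x + y) = A x + A y" "\<And>x. N (A x) \<le> k * N x"
    "\<And>x. A (act ((1/2) *\<^sub>R 1) x) = act ((1/2) *\<^sub>R 1) (A x)" "\<And>x. A (T x) = T (A x)"
  shows "A (L x) = L (A x)"
proof -
  have A0: "A 0 = 0" using A(1)[of 0 0] by simp
  have AY: "A (Y n x) = Y n (A x)" for n x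
    by (induction n arbitrary: x) (simp_all add: A A0)
  have Ad: "A (u - v) = A u - A v" for u v using A(1)[of "u - v" v] by simp
  have "L (A x) = A (L x)"
  proof (rule L_eqI)
    have "N (Y n (A x) - A (L x)) \<le> k * N (Y n x - L x)" for n
      using A(2)[of "Y n x - L x"] by (simp add: AY Ad)
    moreover have "(\<lambda>n. k * N (Y n x - L x)) \<longlonglongrightarrow> 0"
      using tendsto_mult[OF tendsto_const Y_lim] by simp
    ultimately show "(\<lambda>n. N (Y n (A x) - A (L x))) \<longlonglongrightarrow> 0"
      by (rule N_tendsto_zero)
  qed
  then show ?thesis by simp
qed

end

section \<open>Square roots in the algebra and positivity of \<open>star a * a\<close>\<close>

lemma banach_module_self: "banach_module (*) (norm :: 'b::unital_cstar_algebra \<Rightarrow> real)"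
proof
  fix X :: "nat \<Rightarrow> 'b"
  assume "\<forall>e>0. \<exists>k. \<forall>m\<ge>k. \<forall>n\<ge>k. norm (X m - X n) < e"
  then have "Cauchy X" by (simp add: Cauchy_iff)
  then obtain x where "X \<longlonglongrightarrow> x" using Cauchy_convergent convergent_def by blast
  then have "(\<lambda>n. norm (X n - x)) \<longlonglongrightarrow> 0" by (simp add: LIM_zero tendsto_norm_zero)
  then show "\<exists>x. (\<lambda>n. norm (X n - x)) \<longlonglongrightarrow> 0" ..
qed (simp_all add: algebra_simps norm_triangle_ineq norm_mult_ineq)

text \<open>On the algebra as a left module over itself, linear maps are right multiplications:
  \<open>T\<close> is multiplication by \<open>t\<close>, and \<open>r = 1 - L 1\<close>. The bound
  on \<open>1 - r\<close> is the norm criterion for positivity of \<open>r\<close>; the commutation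
  clause serves the absolute value in \<open>cstar_positive_star_mult\<close>.\<close>

lemma selfadjoint_sqrt_one_minus:
  fixes t :: "'b::unital_cstar_algebra"
  assumes t: "star t = t" "norm t \<le> 1"
  shows "\<exists>r. star r = r \<and> r * r = 1 - t \<and> norm (1 - r) \<le> 1 \<and>
    (\<forall>b. b * t = t * b \<longrightarrow> b * r = r * b)"
proof -
  interpret B: banach_module "(*)" "norm :: 'b \<Rightarrow> real" by (rule banach_module_self)
  interpret S: module_contraction "(*)" "norm :: 'b \<Rightarrow> real" "\<lambda>x. x * t"
  proof
    show "B.linear_map (\<lambda>x. x * t)" by (simp add: B.linear_map_def algebra_simps)
    show "norm (x * t) \<le> norm x" for x
      using norm_mult_ineq[of x t] mult_left_mono[OF t(2), of "norm x"] by simp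
  qed
  define l where "l = S.L 1"
  have L: "S.L x = x * l" for x
    using B.linear_mapD(2)[OF S.L_linear, of x 1] by (simp add: l_def)
  have Y: "S.Y n x = x * S.Y n 1" for n x
    using B.linear_mapD(2)[OF S.Y_linear, of n x 1] by simp
  have "star (S.Y n 1) = S.Y n 1" for n
  proof (induction n)
    case (Suc n)
    have "S.Y n (S.Y n 1) = S.Y n 1 * S.Y n 1" by (rule Y)
    then show ?case by (simp add: star_scaleR star_add star_mult Suc t)
  qed simp
  moreover have "(\<lambda>n. norm (star (S.Y n 1) - star l)) \<longlonglongrightarrow> 0"
    using S.Y_lim[of 1] by (simp add: norm_star l_def flip: star_diff)
  ultimately have l: "star l = l"
    using B.N_limit_unique[of "\<lambda>n. S.Y n 1"] S.Y_lim[of 1] by (simp add: l_def)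
  have "(1 - l) * (1 - l) = 1 - t"
    using S.square_root[of 1] by (simp add: L algebra_simps)
  moreover have "norm l \<le> 1"
    using order_trans[OF S.L_norm[of 1] norm_one_le] by (simp add: l_def)
  moreover have "b * (1 - l) = (1 - l) * b" if "b * t = t * b" for b
  proof -
    have "S.L 1 * b = S.L (1 * b)"
      by (rule S.L_commute[where k = "norm b"])
        (simp_all add: distrib_right mult.assoc that norm_mult_ineq mult.commute[of "norm b"])
    then show ?thesis by (simp add: L algebra_simps)
  qed
  moreover have "star (1 - l) = 1 - l" using l by (simp add: star_diff)
  moreover have "norm (1 - (1 - l)) = norm l" by simp
  ultimately show ?thesis by metis
qed

lemma cstar_positive_sqrt:
  fixes a :: "'b::unital_cstar_algebra"
  assumes a: "cstar_positive a"
  shows "\<exists>r. cstar_positive r \<and> r * r = a \<and> (\<forall>b. b * a = a * b \<longrightarrow> b * r = r * b)"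
proof (cases "a = 0")
  case True
  then show ?thesis by (intro exI[of _ 0]) simp
next
  case False
  define c where "c = norm a"
  have c: "c > 0" using False by (simp add: c_def)
  \<comment> \<open>Positivity of \<open>a\<close> enters here: it gives
    \<open>norm (c *\<^sub>R 1 - a) \<le> c\<close>, that is, \<open>norm t \<le> 1\<close>.\<close>
  define t where "t = 1 - (1/c) *\<^sub>R a"
  have sa: "star a = a" using a by (simp add: cstar_positive_def)
  have "t = (1/c) *\<^sub>R (c *\<^sub>R 1 - a)" using c by (simp add: t_def algebra_simps)
  then have nt: "norm t \<le> 1"
    using cstar_positive_norm_diff_le[OF a order_refl] c by (simp add: c_def divide_le_eq)
  have st: "star t = t" by (simp add: t_def star_diff star_scaleR sa)
  obtain r where r: "star r = r" "r * r = 1 - t" "norm (1 - r) \<le> 1"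
    and rc: "\<And>b. b * t = t * b \<Longrightarrow> b * r = r * b"
    using selfadjoint_sqrt_one_minus[OF st nt] by blast
  have "cstar_positive r" using r by (intro cstar_positiveI_norm[of _ 1]) simp_all
  then have "cstar_positive (sqrt c *\<^sub>R r)" using c by (intro cstar_positive_scaleR) simp_all
  moreover have "(sqrt c *\<^sub>R r) * (sqrt c *\<^sub>R r) = a"
    using c by (simp add: r(2) t_def)
  moreover have "b * (sqrt c *\<^sub>R r) = (sqrt c *\<^sub>R r) * b" if "b * a = a * b" for b
  proof -
    have "b * t = t * b" using that by (simp add: t_def algebra_simps)
    from rc[OF this] show ?thesis by simp
  qed
  ultimately show ?thesis by blast
qed

text \<open>With \<open>c = p + \<i> q\<close> the cross terms \<open>\<i> (p q - q p)\<close> of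
  \<open>star c * c\<close> and \<open>c * star c\<close> cancel.\<close>

lemma cartesian_decomposition:
  fixes c :: "'b::unital_cstar_algebra"
  obtains p q where "star p = p" "star q = q" "star c * c + c * star c = 2 *\<^sub>R (p * p + q * q)"
proof
  define p where "p = (1/2) *\<^sub>R (c + star c)"
  define q where "q = (- \<i> / 2) *\<^sub>C (c - star c)"
  show "star p = p" by (simp add: p_def star_scaleR star_add star_star add.commute)
  show "star q = q"
    by (simp add: q_def star_scaleC star_diff star_star scaleC_diff_right scaleC_minus_left)
  have "q * q = (- 1/4) *\<^sub>R ((c - star c) * (c - star c))"
  proof -
    have "(- \<i> / 2) * (- \<i> / 2) = complex_of_real (- 1/4)" by simp
    then show ?thesis
      unfolding q_def mult_scaleC_left mult_scaleC_right scaleC_scaleC by (simp only: scaleC_of_real)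
  qed
  then have "4 *\<^sub>R (q * q) = - ((c - star c) * (c - star c))" by simp
  moreover have "4 *\<^sub>R (p * p) = (c + star c) * (c + star c)" by (simp add: p_def)
  ultimately have "4 *\<^sub>R (p * p + q * q) = (c + star c) * (c + star c) - (c - star c) * (c - star c)"
    by (simp add: scaleR_add_right)
  also have "\<dots> = 2 *\<^sub>R (star c * c + c * star c)"
    by (simp add: algebra_simps scaleR_2)
  finally have "(1/2) *\<^sub>R (4 *\<^sub>R (p * p + q * q)) = (1/2) *\<^sub>R (2 *\<^sub>R (star c * c + c * star c))"
    by simp
  then show "star c * c + c * star c = 2 *\<^sub>R (p * p + q * q)" by simp
qed

text \<open>If \<open>star a * a = b\<close> had a negative part, then \<open>c = a * (\<bar>b\<bar> - b)\<close> would satisfy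
  \<open>star c * c \<le> 0\<close>, hence also \<open>c * star c \<le> 0\<close>, although the sum of the two is a sum of squares.\<close>

lemma cstar_positive_star_mult:
  fixes a :: "'b::unital_cstar_algebra"
  shows "cstar_positive (star a * a)"
proof -
  define b where "b = star a * a"
  have sb: "star b = b" by (simp add: b_def star_mult star_star)
  \<comment> \<open>\<open>m\<close> is the absolute value of \<open>b\<close> and \<open>s\<close>
    its square root; by the commutation clauses \<open>b\<close>, \<open>m\<close> and
    \<open>s\<close> commute.\<close>
  obtain m where m: "cstar_positive m" "m * m = b * b"
    and mc: "\<And>x. x * (b * b) = (b * b) * x \<Longrightarrow> x * m = m * x"
    using cstar_positive_sqrt[OF cstar_positive_square[OF sb]] by blast
  obtain s where s: "cstar_positive s" "s * s = m"
    and sc: "\<And>x. x * m = m * x \<Longrightarrow> x * s = s * x"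
    using cstar_positive_sqrt[OF m(1)] by blast
  have sm: "star m = m" "star s = s" using m s by (simp_all add: cstar_positive_def)
  have bm: "b * m = m * b" by (intro mc) (simp add: mult.assoc)
  have bs: "b * s = s * b" by (intro sc bm)
  have ms: "m * s = s * m" by (intro sc) simp
  define e where "e = m - b"
  have es: "e * s = s * e" by (simp add: e_def algebra_simps bs ms)
  have se: "star e = e" by (simp add: e_def star_diff sm sb)
  have eb: "e * b = - (e * m)" by (simp add: e_def algebra_simps bm m)
  have be: "b * e = - (m * e)" by (simp add: e_def algebra_simps bm m)
  \<comment> \<open>\<open>star c * c = e * b * e = - (e * m * e)\<close>, and
    \<open>m = s * s\<close> exhibits \<open>e * m * e\<close> as the square of the self-adjoint
    \<open>k\<close>.\<close>
  define k where "k = e * s"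
  have sk: "star k = k" by (simp add: k_def star_mult se sm es)
  have kk: "k * k = e * (m * e)"
  proof -
    have "k * k = e * s * (s * e)" by (simp add: k_def es)
    then show ?thesis by (simp add: mult.assoc s(2)[symmetric])
  qed
  define c where "c = a * e"
  have cc: "star c * c = - (k * k)"
  proof -
    have "star c * c = e * (b * e)" by (simp add: c_def star_mult se b_def mult.assoc)
    then show ?thesis by (simp add: be kk)
  qed
  have pk: "cstar_positive (k * k)" by (rule cstar_positive_square[OF sk])
  \<comment> \<open>Apart from 0, \<open>star c * c\<close> and \<open>c * star c\<close> have the
    same spectrum, so the sign carries over.\<close>
  have "cstar_positive (- (c * star c))"
    unfolding cstar_positive_def
  proof (intro conjI subsetI)
    show "star (- (c * star c)) = - (c * star c)" by (simp add: star_minus star_mult star_star)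
    fix z assume z: "z \<in> cstar_spectrum (- (c * star c))"
    show "z \<in> \<real>\<^sub>\<ge>\<^sub>0"
    proof (cases "z = 0")
      case False
      from spectrum_minus[OF z] have "- z \<in> cstar_spectrum (c * star c)" by simp
      from spectrum_mult_commute[OF this] have "- z \<in> cstar_spectrum (star c * c)" using False by simp
      then have "z \<in> cstar_spectrum (k * k)" using spectrum_minus[of "- z" "star c * c"] by (simp add: cc)
      then show ?thesis using pk by (auto simp: cstar_positive_def)
    qed simp
  qed
  moreover obtain p q where "star p = p" "star q = q"
    and pq: "star c * c + c * star c = 2 *\<^sub>R (p * p + q * q)"
    by (rule cartesian_decomposition)
  then have "cstar_positive (star c * c + c * star c)"
    unfolding pq by (intro cstar_positive_scaleR cstar_positive_add cstar_positive_square) simp_all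
  ultimately have "cstar_positive (- (k * k))"
    using cstar_positive_add[of "star c * c + c * star c" "- (c * star c)"] cc by simp
  then have "k * k = 0" using cstar_positive_antisym pk by blast
  then have "k = 0" using norm_square_selfadjoint[OF sk] by simp
  \<comment> \<open>\<open>k = 0\<close> says \<open>e * s = 0\<close>; another factor
    \<open>s\<close> gives \<open>e * m = 0\<close>, and \<open>e * b = - (e * m)\<close> then kills
    \<open>e * e\<close>.\<close>
  then have "e * m = 0" by (metis k_def mult.assoc mult_zero_left s(2))
  then have "e * e = 0" by (simp add: right_diff_distrib[of e m b, folded e_def] eb)
  then have "e = 0" using norm_square_selfadjoint[OF se] by simp
  then have "b = m" by (simp add: e_def)
  then show ?thesis using m by (simp add: b_def)
qed

lemma cstar_positive_conjugate:
  fixes a b :: "'b::unital_cstar_algebra"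
  assumes "cstar_positive a"
  shows "cstar_positive (b * a * star b)"
proof -
  obtain r where r: "cstar_positive r" "r * r = a"
    using cstar_positive_sqrt[OF assms] by blast
  have "star (r * star b) * (r * star b) = b * a * star b"
    using cstar_positive_selfadjoint[OF r(1)]
    by (simp add: star_mult star_star mult.assoc flip: r(2))
  then show ?thesis using cstar_positive_star_mult by metis
qed

lemma cstar_positive_mult_star: "cstar_positive (a * star (a::'b::unital_cstar_algebra))"
  by (metis cstar_positive_star_mult star_star)

section \<open>Frames of finitely generated Hilbert modules\<close>

context hilbert_module
begin

section \<open>Cauchy-Schwarz inequality and frame expansions\<close>

lemma ip_act_left: "ip (act a x) y = a * ip x y"
  using ip_linear[of a x 0 0 y] by simp

lemma ip_add_left: "ip (x + y) z = ip x z + ip y z"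
  using ip_linear[of 1 x 1 y z] by (simp add: act_one)

lemma ip_zero_left [simp]: "ip 0 y = 0"
  using ip_act_left[of 0 0 y] by simp

lemma ip_minus_left: "ip (- x) y = - ip x y"
  using ip_add_left[of x "- x" y] by (simp add: eq_neg_iff_add_eq_0 add.commute)

lemma ip_diff_left: "ip (x - y) z = ip x z - ip y z"
  using ip_add_left[of x "- y" z] by (simp add: ip_minus_left)

lemma ip_sum_left: "ip (\<Sum>i\<in>A. f i) y = (\<Sum>i\<in>A. ip (f i) y)"
  by (induction A rule: infinite_finite_induct) (simp_all add: ip_add_left)

lemma ip_act_right: "ip x (act a y) = ip x y * star a"
  unfolding ip_star[of x "act a y"] ip_act_left star_mult by (simp flip: ip_star)

lemma ip_add_right: "ip x (y + z) = ip x y + ip x z"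
  unfolding ip_star[of x "y + z"] ip_add_left star_add by (simp flip: ip_star)

lemma ip_zero_right [simp]: "ip x 0 = 0"
  unfolding ip_star[of x 0] by simp

lemma ip_diff_right: "ip x (y - z) = ip x y - ip x z"
  unfolding ip_star[of x "y - z"] ip_diff_left star_diff by (simp flip: ip_star)

lemma ip_sum_right: "ip y (\<Sum>i\<in>A. f i) = (\<Sum>i\<in>A. ip y (f i))"
  by (induction A rule: infinite_finite_induct) (simp_all add: ip_add_right)

lemma ip_scaleR_left: "ip (act (r *\<^sub>R 1) x) y = r *\<^sub>R ip x y"
  by (simp add: ip_act_left)

lemma ip_scaleR_right: "ip x (act (r *\<^sub>R 1) y) = r *\<^sub>R ip x y"
  by (simp add: ip_act_right star_scaleR)

text \<open>Conjugating \<open>ip y y \<le> norm (ip y y)\<close> by \<open>b\<close> pulls the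
  middle factor of \<open>b * ip y y * star b\<close> out as a number, which makes up for the lack
  of commutativity.\<close>

lemma ip_conjugate_le: "cstar_positive (norm (ip y y) *\<^sub>R (b * star b) - ip (act b y) (act b y))"
proof -
  have "cstar_positive (b * (norm (ip y y) *\<^sub>R 1 - ip y y) * star b)"
    by (intro cstar_positive_conjugate cstar_positive_norm_diff ip_positive order_refl)
  then show ?thesis by (simp add: ip_act_left ip_act_right algebra_simps)
qed

text \<open>The inner square of \<open>c x - b y\<close>, with \<open>c = norm (ip y y)\<close> and
  \<open>b = ip x y\<close>, avoids dividing by \<open>ip y y\<close>, which need not be invertible;
  \<open>ip_conjugate_le\<close> then leaves
  \<open>c (b * star b) \<le> c\<^sup>2 ip x x\<close>.\<close>

lemma cauchy_schwarz: "(norm (ip x y))\<^sup>2 \<le> norm (ip x x) * norm (ip y y)"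
proof (cases "y = 0")
  case False
  define c b where "c = norm (ip y y)" and "b = ip x y"
  have c: "c > 0" using False by (simp add: c_def ip_eq_zero_iff)
  have yx: "ip y x = star b" by (simp add: b_def ip_star[of y x])
  have "ip (act (c *\<^sub>R 1) x - act b y) (act (c *\<^sub>R 1) x - act b y) =
      (c * c) *\<^sub>R ip x x - (2 * c) *\<^sub>R (b * star b) + ip (act b y) (act b y)"
    by (simp add: ip_diff_left ip_diff_right ip_scaleR_left ip_scaleR_right ip_act_right[of _ b]
        ip_act_left[of b] yx flip: b_def) (simp add: algebra_simps scaleR_2 flip: scaleR_scaleR)
  then have "cstar_positive ((c * c) *\<^sub>R ip x x - (2 * c) *\<^sub>R (b * star b) + ip (act b y) (act b y))"
    using ip_positive by metis
  from cstar_positive_add[OF this ip_conjugate_le[of y b]]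
  have "cstar_positive ((c * c) *\<^sub>R ip x x - c *\<^sub>R (b * star b))"
    by (simp add: algebra_simps scaleR_2 flip: c_def scaleR_scaleR)
  then have "norm (c *\<^sub>R (b * star b)) \<le> norm ((c * c) *\<^sub>R ip x x)"
    using c by (intro cstar_positive_norm_mono cstar_positive_scaleR cstar_positive_mult_star) auto
  then have "c * (norm b)\<^sup>2 \<le> c * (c * norm (ip x x))"
    using c by (simp add: norm_mult_star mult.assoc)
  then show ?thesis using c by (simp add: b_def c_def mult.commute)
qed simp

abbreviation N :: "'m \<Rightarrow> real" where "N \<equiv> hilbert_norm ip"

lemma N_square: "(N x)\<^sup>2 = norm (ip x x)"
  by (simp add: hilbert_norm_def)

lemma norm_ip_le: "norm (ip x y) \<le> N x * N y"
  using real_le_rsqrt[OF cauchy_schwarz[of x y]]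
  by (simp add: hilbert_norm_def real_sqrt_mult)

sublocale banach_module act N
proof
  show "N (x + y) \<le> N x + N y" for x y
  proof (rule power2_le_imp_le)
    have "(N (x + y))\<^sup>2 = norm (ip x x + ip x y + (ip y x + ip y y))"
      by (simp add: N_square ip_add_left ip_add_right add_ac)
    also have "\<dots> \<le> norm (ip x x) + norm (ip x y) + (norm (ip y x) + norm (ip y y))"
      by (intro norm_triangle_mono order_refl)
    also have "\<dots> \<le> (N x)\<^sup>2 + N x * N y + (N y * N x + (N y)\<^sup>2)"
      unfolding N_square by (intro add_mono norm_ip_le order_refl)
    finally show "(N (x + y))\<^sup>2 \<le> (N x + N y)\<^sup>2" by (simp add: power2_eq_square algebra_simps)
  qed (simp add: hilbert_norm_def)
  show "N (act a x) \<le> norm a * N x" for a x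
  proof (rule power2_le_imp_le)
    have "(N (act a x))\<^sup>2 = norm (a * ip x x * star a)"
      by (simp add: N_square ip_act_left ip_act_right mult.assoc)
    also have "\<dots> \<le> norm a * norm (ip x x) * norm (star a)"
      by (meson mult_right_mono norm_ge_zero norm_mult_ineq order_trans)
    finally show "(N (act a x))\<^sup>2 \<le> (norm a * N x)\<^sup>2"
      by (simp add: norm_star power_mult_distrib N_square power2_eq_square[of "norm a"] mult_ac)
  qed (simp add: hilbert_norm_def)
  show "N x = 0 \<Longrightarrow> x = 0" for x
    by (simp add: hilbert_norm_def ip_eq_zero_iff)
qed (rule complete)

lemma ip_eqI:
  assumes "\<And>y. ip x y = ip z y"
  shows "x = z"
proof -
  have "ip (x - z) (x - z) = 0" by (simp add: ip_diff_left[of x z] assms)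
  then show ?thesis by (simp add: ip_eq_zero_iff)
qed

lemma N_le_of_positive:
  assumes "cstar_positive (ip y y - ip x x)"
  shows "N x \<le> N y"
  using cstar_positive_norm_mono[OF ip_positive assms] by (simp add: hilbert_norm_def)

text \<open>By the parallelogram law each added term costs a factor 2. At
  \<open>b i = ip x (g i)\<close> this becomes the upper bound \<open>S\<^sup>2 \<le> C S\<close>
  for the frame operator.\<close>

lemma ip_combination_le:
  fixes g :: "nat \<Rightarrow> 'm"
  shows "\<exists>C>0. \<forall>b. cstar_positive (C *\<^sub>R (\<Sum>i<n. b i * star (b i)) -
    ip (\<Sum>i<n. act (b i) (g i)) (\<Sum>i<n. act (b i) (g i)))"
proof (induction n)
  case 0
  show ?case by (intro exI[of _ 1]) simp
next
  case (Suc n)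
  then obtain C where C: "C > 0" and le: "\<And>b. cstar_positive (C *\<^sub>R (\<Sum>i<n. b i * star (b i)) -
      ip (\<Sum>i<n. act (b i) (g i)) (\<Sum>i<n. act (b i) (g i)))" by blast
  define k where "k = norm (ip (g n) (g n))"
  have k: "k \<ge> 0" by (simp add: k_def)
  have "cstar_positive ((2 * C + 2 * k) *\<^sub>R (\<Sum>i<Suc n. b i * star (b i)) -
    ip (\<Sum>i<Suc n. act (b i) (g i)) (\<Sum>i<Suc n. act (b i) (g i)))" for b
  proof -
    define B e u v where "B = (\<Sum>i<n. b i * star (b i))" and "e = b n * star (b n)"
      and "u = (\<Sum>i<n. act (b i) (g i))" and "v = act (b n) (g n)"
    have 1: "cstar_positive (C *\<^sub>R B - ip u u)" using le by (simp add: B_def u_def)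
    have 2: "cstar_positive (k *\<^sub>R e - ip v v)"
      using ip_conjugate_le by (simp add: k_def e_def v_def)
    have 3: "cstar_positive B" "cstar_positive e"
      by (auto simp: B_def e_def intro: cstar_positive_sum cstar_positive_mult_star)
    have "(2 * C + 2 * k) *\<^sub>R (B + e) - ip (u + v) (u + v) = 2 *\<^sub>R (C *\<^sub>R B - ip u u) +
        2 *\<^sub>R (k *\<^sub>R e - ip v v) + ip (u - v) (u - v) + (2 * k) *\<^sub>R B + (2 * C) *\<^sub>R e"
      by (simp add: ip_add_left ip_add_right ip_diff_left ip_diff_right algebra_simps scaleR_2)
    also have "cstar_positive \<dots>"
      using C k 1 2 3 by (intro cstar_positive_add cstar_positive_scaleR ip_positive) auto
    finally show ?thesis by (simp add: B_def e_def u_def v_def)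
  qed
  then show ?case using C k by (intro exI[of _ "2 * C + 2 * k"]) simp
qed

text \<open>Polarization: the defect \<open>D x y\<close> of the expansion satisfies \<open>D x y + star (D x y) = 0\<close>;
  replacing \<open>x\<close> by \<open>star (D x y) x\<close> turns this into \<open>star (D x y) * D x y = 0\<close>.\<close>

lemma normalized_tight_frame_expansion:
  assumes f: "normalized_tight_frame ip xs"
  shows "x = (\<Sum>i<length xs. act (ip x (xs ! i)) (xs ! i))"
proof (rule ip_eqI)
  fix y
  define D where "D x y = ip x y - (\<Sum>i<length xs. ip x (xs ! i) * ip (xs ! i) y)" for x y
  have D0: "D x x = 0" for x using f by (simp add: D_def normalized_tight_frame_def)
  have Dadd: "D (x + x') y = D x y + D x' y" "D y (x + x') = D y x + D y x'" for x x' y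
    by (simp_all add: D_def ip_add_left ip_add_right sum.distrib algebra_simps)
  have Dact: "D (act a x) y = a * D x y" for a x y
    by (simp add: D_def ip_act_left sum_distrib_left right_diff_distrib mult.assoc)
  have Dstar: "D y x = star (D x y)" for x y
    unfolding D_def star_diff star_sum star_mult by (simp only: flip: ip_star)
  have anti: "D x y + star (D x y) = 0" for x y
  proof -
    have "D (x + y) (x + y) = D x y + D y x" unfolding Dadd by (simp add: D0)
    then show ?thesis by (simp add: D0 flip: Dstar)
  qed
  have "star (D x y) * D x y + star (D x y) * D x y = 0"
    using anti[of "act (star (D x y)) x" y] by (simp add: Dact star_mult star_star)
  then have "2 *\<^sub>R (star (D x y) * D x y) = 0" by (simp add: scaleR_2)
  then have "D x y = 0" using cstar_identity[of "D x y"] by simp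
  then show "ip x y = ip (\<Sum>i<length xs. act (ip x (xs ! i)) (xs ! i)) y"
    by (simp add: D_def ip_sum_left ip_act_left)
qed

end

section \<open>The frame operator of a generating list\<close>

locale generated_hilbert_module = hilbert_module act ip
  for act :: "'b::unital_cstar_algebra \<Rightarrow> 'm::ab_group_add \<Rightarrow> 'm" and ip +
  fixes gs :: "'m list"
  assumes generated: "\<exists>c. x = (\<Sum>i<length gs. act (c i) (gs ! i))"
begin

definition frame_op :: "'m \<Rightarrow> 'm" where
  "frame_op x = (\<Sum>i<length gs. act (ip x (gs ! i)) (gs ! i))"

definition frame_form :: "'m \<Rightarrow> 'b" where
  "frame_form x = (\<Sum>i<length gs. ip x (gs ! i) * ip (gs ! i) x)"

lemma frame_op_linear: "linear_map frame_op"
  by (simp add: linear_map_def frame_op_def ip_add_left ip_act_left act_add_left sum.distrib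
      act_sum_right act_act)

lemma ip_frame_op: "ip (frame_op x) y = (\<Sum>i<length gs. ip x (gs ! i) * ip (gs ! i) y)"
  by (simp add: frame_op_def ip_sum_left ip_act_left)

lemma ip_frame_op_self: "ip (frame_op x) x = frame_form x"
  by (simp add: ip_frame_op frame_form_def)

lemma ip_frame_op_right: "ip x (frame_op y) = ip (frame_op x) y"
  unfolding ip_frame_op by (simp add: frame_op_def ip_sum_right ip_act_right flip: ip_star)

lemma frame_form_alt: "frame_form x = (\<Sum>i<length gs. ip x (gs ! i) * star (ip x (gs ! i)))"
  by (simp add: frame_form_def flip: ip_star)

lemma frame_form_positive: "cstar_positive (frame_form x)"
  unfolding frame_form_alt by (intro cstar_positive_sum cstar_positive_mult_star)

lemma frame_op_bound:
  "\<exists>C>0. \<forall>x. cstar_positive (C *\<^sub>R frame_form x - ip (frame_op x) (frame_op x))"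
proof -
  obtain C where "C > 0" "\<forall>b. cstar_positive (C *\<^sub>R (\<Sum>i<length gs. b i * star (b i)) -
      ip (\<Sum>i<length gs. act (b i) (gs ! i)) (\<Sum>i<length gs. act (b i) (gs ! i)))"
    using ip_combination_le[of "length gs" "\<lambda>i. gs ! i"] by blast
  then show ?thesis unfolding frame_form_alt frame_op_def by (intro exI[of _ C]) simp
qed

lemma norm_ip_generator_le: "i < length gs \<Longrightarrow> norm (ip x (gs ! i)) \<le> sqrt (norm (frame_form x))"
proof (rule real_le_rsqrt)
  let ?f = "\<lambda>i. ip x (gs ! i) * star (ip x (gs ! i))"
  assume i: "i < length gs"
  have "frame_form x - ?f i = (\<Sum>j\<in>{..<length gs} - {i}. ?f j)"
    using i by (simp add: frame_form_alt sum.remove[of "{..<length gs}" i])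
  then have "cstar_positive (frame_form x - ?f i)"
    by (simp add: cstar_positive_sum cstar_positive_mult_star)
  then have "norm (?f i) \<le> norm (frame_form x)"
    by (intro cstar_positive_norm_mono cstar_positive_mult_star)
  then show "(norm (ip x (gs ! i)))\<^sup>2 \<le> norm (frame_form x)"
    by (simp add: norm_mult_star)
qed

text \<open>Every \<open>y\<close> is a combination of the generators, so \<open>x \<mapsto> \<langle>x, y\<rangle>\<close> is bounded relative to the frame
  form; by Baire category the bound is uniform for \<open>y\<close> in a ball.\<close>

lemma frame_lower_bound: "\<exists>K>0. \<forall>x. N x \<le> K * sqrt (norm (frame_form x))"
proof -
  define q where "q x = sqrt (norm (frame_form x))" for x
  have q: "0 \<le> q x" for x by (simp add: q_def)
  define F where "F m = {y. \<forall>x. norm (ip x y) \<le> real m * q x}" for m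
  have "\<exists>m. y \<in> F m" for y
  proof -
    obtain c where c: "y = (\<Sum>i<length gs. act (c i) (gs ! i))" using generated by blast
    obtain m where m: "(\<Sum>i<length gs. norm (c i)) \<le> real m" using real_arch_simple by blast
    have "norm (ip x y) \<le> real m * q x" for x
    proof -
      have "ip x y = (\<Sum>i<length gs. ip x (gs ! i) * star (c i))"
        by (simp add: c ip_sum_right ip_act_right)
      also have "norm \<dots> \<le> (\<Sum>i<length gs. norm (c i) * q x)"
      proof (intro sum_norm_le)
        fix i assume "i \<in> {..<length gs}"
        then have "norm (ip x (gs ! i)) \<le> q x" by (simp add: q_def norm_ip_generator_le)
        then have "norm (ip x (gs ! i)) * norm (star (c i)) \<le> q x * norm (c i)"
          unfolding norm_star by (rule mult_right_mono) simp
        then show "norm (ip x (gs ! i) * star (c i)) \<le> norm (c i) * q x"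
          using norm_mult_ineq[of "ip x (gs ! i)" "star (c i)"] by (simp add: mult.commute)
      qed
      also have "\<dots> = (\<Sum>i<length gs. norm (c i)) * q x" by (simp add: sum_distrib_right)
      also have "\<dots> \<le> real m * q x" by (rule mult_right_mono[OF m q])
      finally show ?thesis .
    qed
    then show ?thesis by (auto simp: F_def)
  qed
  then have U: "\<Union>(range F) = UNIV" by blast
  have closed: "closedin N_metric.mtopology (F m)" for m
    unfolding N_metric.closedin_metric
  proof (intro conjI allI impI)
    fix y assume "y \<in> UNIV - F m"
    then obtain x where x: "norm (ip x y) > real m * q x" by (auto simp: F_def not_le)
    \<comment> \<open>\<open>(N x + 1) * r\<close> is the margin by which \<open>y\<close> violates
      the bound; the added 1 covers \<open>N x = 0\<close>.\<close>
    define r where "r = (norm (ip x y) - real m * q x) / (N x + 1)"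
    have r: "r > 0" using x by (simp add: r_def add_nonneg_pos)
    have "z \<notin> F m" if z: "N (y - z) < r" for z
    proof -
      have "norm (ip x y) - norm (ip x z) \<le> norm (ip x (y - z))"
        by (simp add: ip_diff_right norm_triangle_ineq2)
      also have "\<dots> \<le> N x * N (y - z)" by (rule norm_ip_le)
      also have "\<dots> \<le> N x * r" using z by (intro mult_left_mono) auto
      also have "\<dots> < (N x + 1) * r" using r by (simp add: distrib_right)
      also have "\<dots> = norm (ip x y) - real m * q x"
        using N_nonneg[of x] by (simp add: r_def add_nonneg_eq_0_iff)
      finally have "norm (ip x z) > real m * q x" by simp
      then show ?thesis by (auto simp: F_def not_le)
    qed
    then show "\<exists>r>0. disjnt (F m) (N_metric.mball y r)"
      using r by (intro exI[of _ r]) (auto simp: disjnt_def)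
  qed simp
  have "\<exists>m. N_metric.mtopology interior_of (F m) \<noteq> {}"
  proof (rule ccontr)
    assume "\<not> ?thesis"
    then have "N_metric.mtopology interior_of \<Union>(range F) = {}"
      by (intro N_metric.metric_Baire_category_alt[OF N_mcomplete]) (auto simp: closed)
    then show False
      unfolding U using interior_of_topspace[of N_metric.mtopology] by simp
  qed
  then obtain m y0 where y0: "y0 \<in> N_metric.mtopology interior_of (F m)" by blast
  then obtain r where r: "r > 0" and "N_metric.mball y0 r \<subseteq> N_metric.mtopology interior_of (F m)"
    using openin_interior_of[of N_metric.mtopology "F m"] unfolding N_metric.openin_mtopology by blast
  then have sub: "N_metric.mball y0 r \<subseteq> F m" using interior_of_subset by fastforce
  \<comment> \<open>A small \<open>y\<close> is the difference of two points of the ball around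
    \<open>y0\<close>, whence the factor 2.\<close>
  have small: "norm (ip x y) \<le> 2 * real m * q x" if y: "N y < r" for x y
  proof -
    have "y0 \<in> F m" "y0 + y \<in> F m" using y r by (auto intro!: subsetD[OF sub] simp: N_minus)
    then have "norm (ip x y0) \<le> real m * q x" "norm (ip x (y0 + y)) \<le> real m * q x"
      by (simp_all add: F_def)
    moreover have "ip x y = ip x (y0 + y) - ip x y0" by (simp add: ip_add_right)
    ultimately show ?thesis using norm_triangle_ineq4[of "ip x (y0 + y)" "ip x y0"] by simp
  qed
  \<comment> \<open>\<open>4 * real m / r\<close> results from testing \<open>small\<close> on the
    multiple \<open>t x\<close> of norm at most \<open>r / 2\<close>; the added 1 keeps
    \<open>K\<close> positive for \<open>m = 0\<close>.\<close>
  define K where "K = 4 * real m / r + 1"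
  have K: "K > 0" using r by (simp add: K_def add_nonneg_pos)
  have "N x \<le> K * q x" for x
  proof (cases "N x = 0")
    case True
    then show ?thesis using K q[of x] by simp
  next
    case False
    then have Nx: "N x > 0" using N_nonneg[of x] by linarith
    define t where "t = r / (2 * N x)"
    have t: "t > 0" using r Nx by (simp add: t_def)
    have "N (act (t *\<^sub>R 1) x) \<le> t * N x" using N_scaleR[of t x] t by simp
    also have "\<dots> < r" using r Nx by (simp add: t_def)
    finally have "norm (ip x (act (t *\<^sub>R 1) x)) \<le> 2 * real m * q x" by (rule small)
    then have "t * (N x)\<^sup>2 \<le> 2 * real m * q x"
      using t by (simp add: ip_scaleR_right N_square)
    then have "N x \<le> 4 * real m / r * q x"
      using r Nx by (simp add: t_def field_simps power2_eq_square)
    also have "\<dots> \<le> K * q x" using q[of x] by (simp add: K_def distrib_right)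
    finally show ?thesis .
  qed
  then show ?thesis using K by (auto simp: q_def)
qed

text \<open>A shift by \<open>t \<ge> 0\<close> only increases the form \<open>ip (S x) x\<close>,
  so one constant serves all \<open>t\<close>. This uniformity is what lets
  \<open>frame_op_bij\<close> return to \<open>t = 0\<close>.\<close>

lemma frame_op_shift_bounded_below:
  "\<exists>M>0. \<forall>t\<ge>0. \<forall>x. N x \<le> M * N (frame_op x + act (t *\<^sub>R 1) x)"
proof -
  obtain K where K: "K > 0" "\<And>x. N x \<le> K * sqrt (norm (frame_form x))"
    using frame_lower_bound by blast
  have "N x \<le> K\<^sup>2 * N (frame_op x + act (t *\<^sub>R 1) x)" if t: "t \<ge> 0" for t x
  proof (cases "N x = 0")
    case False
    then have Nx: "N x > 0" using N_nonneg[of x] by linarith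
    let ?z = "frame_op x + act (t *\<^sub>R 1) x"
    have "N x * N x \<le> (K * sqrt (norm (frame_form x)))\<^sup>2"
      using power_mono[OF K(2), of x 2] by (simp add: power2_eq_square)
    also have "\<dots> = K\<^sup>2 * norm (frame_form x)" by (simp add: power_mult_distrib)
    also have "\<dots> \<le> K\<^sup>2 * norm (ip ?z x)"
    proof (intro mult_left_mono cstar_positive_norm_mono frame_form_positive)
      show "cstar_positive (ip ?z x - frame_form x)"
        using t by (simp add: ip_add_left ip_frame_op_self ip_scaleR_left cstar_positive_scaleR ip_positive)
    qed simp
    also have "\<dots> \<le> K\<^sup>2 * (N ?z * N x)" by (intro mult_left_mono norm_ip_le) simp
    finally show ?thesis using Nx by simp
  qed simp
  then show ?thesis using K(1) by (intro exI[of _ "K\<^sup>2"]) simp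
qed

text \<open>\<open>1 - (1 - S / C)\<^sup>2 = S / C + (C S - S\<^sup>2) / C\<^sup>2\<close> is
  nonnegative by \<open>frame_op_bound\<close>. The operator \<open>1 - S / C\<close> is used both
  to invert shifts of \<open>S\<close> and to take its square root.\<close>

lemma frame_op_contraction:
  "\<exists>C>0. \<forall>x. N (x - act ((1/C) *\<^sub>R 1) (frame_op x)) \<le> N x"
proof -
  obtain C where C: "C > 0"
    and le: "\<And>x. cstar_positive (C *\<^sub>R frame_form x - ip (frame_op x) (frame_op x))"
    using frame_op_bound by blast
  have "N (x - act ((1/C) *\<^sub>R 1) (frame_op x)) \<le> N x" for x
  proof (rule N_le_of_positive)
    let ?s = "frame_op x"
    have "ip x x - ip (x - act ((1/C) *\<^sub>R 1) ?s) (x - act ((1/C) *\<^sub>R 1) ?s) =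
      (1/C) *\<^sub>R frame_form x + (1/C) *\<^sub>R frame_form x - (1/C * (1/C)) *\<^sub>R ip ?s ?s"
      by (simp add: ip_diff_left ip_diff_right ip_scaleR_left ip_scaleR_right ip_frame_op_self
          ip_frame_op_right[of x x] algebra_simps)
    also have "\<dots> = (1/C) *\<^sub>R frame_form x + (1/C * (1/C)) *\<^sub>R (C *\<^sub>R frame_form x - ip ?s ?s)"
      using C by (simp add: scaleR_diff_right)
    also have "cstar_positive \<dots>"
      using C by (intro cstar_positive_add cstar_positive_scaleR frame_form_positive le) auto
    finally show "cstar_positive (ip x x - ip (x - act ((1/C) *\<^sub>R 1) ?s) (x - act ((1/C) *\<^sub>R 1) ?s))" .
  qed
  then show ?thesis using C by blast
qed

text \<open>\<open>S + t = (C + t) (1 - k (1 - S / C))\<close> with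
  \<open>k = C / (C + t) < 1\<close>. At \<open>t = 0\<close> the factor \<open>k\<close> would be
  1, so \<open>S\<close> itself is out of reach of this argument.\<close>

lemma frame_op_shift_surj:
  assumes t: "t > 0"
  shows "\<exists>x. frame_op x + act (t *\<^sub>R 1) x = y"
proof -
  obtain C where C: "C > 0" "\<And>x. N (x - act ((1/C) *\<^sub>R 1) (frame_op x)) \<le> N x"
    using frame_op_contraction by blast
  define k where "k = C / (C + t)"
  have k: "0 < k" "k < 1" using C t by (simp_all add: k_def)
  define A where "A x = act (k *\<^sub>R 1) (x - act ((1/C) *\<^sub>R 1) (frame_op x))" for x
  have "linear_map A"
    by (simp add: linear_map_def A_def linear_mapD[OF frame_op_linear] act_add_right act_diff_right
        act_act algebra_simps)
  moreover have "N (A x) \<le> k * N x" for x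
    using order_trans[OF N_scaleR[of k "x - act ((1/C) *\<^sub>R 1) (frame_op x)"]
      mult_left_mono[OF C(2)[of x], of "\<bar>k\<bar>"]] k
    by (simp add: A_def)
  ultimately obtain x where x: "x = act ((1/(C+t)) *\<^sub>R 1) y + A x"
    using contraction_solve k by blast
  have "act ((C + t) *\<^sub>R 1) x = act ((C + t) *\<^sub>R 1) (act ((1/(C+t)) *\<^sub>R 1) y + A x)"
    using x by simp
  also have "\<dots> = y + act (C *\<^sub>R 1) x - frame_op x"
    using C t by (simp add: A_def k_def act_add_right act_diff_right act_act act_one)
  finally have "act (C *\<^sub>R 1) x + act (t *\<^sub>R 1) x = y + act (C *\<^sub>R 1) x - frame_op x"
    by (simp add: scaleR_add_left act_add_left)
  then have "frame_op x + act (t *\<^sub>R 1) x = y" by (simp add: algebra_simps)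
  then show ?thesis ..
qed

text \<open>Continuation to \<open>t = 0\<close>: if \<open>J\<close> inverts \<open>S + t\<close>,
  then \<open>S x = y\<close> amounts to \<open>x = J y + t J x\<close>. As \<open>J\<close> is
  bounded by \<open>M\<close> whatever \<open>t\<close> is, \<open>t = 1 / (2 * M)\<close> makes
  this a contraction with factor 1/2.\<close>

lemma frame_op_bij: "bij frame_op"
proof -
  obtain M where M: "M > 0" "\<And>t x. t \<ge> 0 \<Longrightarrow> N x \<le> M * N (frame_op x + act (t *\<^sub>R 1) x)"
    using frame_op_shift_bounded_below by blast
  have inj: "x = z" if "t \<ge> 0" "frame_op x + act (t *\<^sub>R 1) x = frame_op z + act (t *\<^sub>R 1) z" for t x z
  proof -
    have "frame_op (x - z) + act (t *\<^sub>R 1) (x - z) = 0"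
      using that(2) by (simp add: linear_mapD[OF frame_op_linear] act_diff_right algebra_simps)
    then have "N (x - z) = 0" using M(2)[OF that(1), of "x - z"] N_nonneg[of "x - z"] by simp
    then show ?thesis using N_eq_0[of "x - z"] by simp
  qed
  define t where "t = 1 / (2 * M)"
  have t: "t > 0" using M by (simp add: t_def)
  obtain J where J: "\<And>y. frame_op (J y) + act (t *\<^sub>R 1) (J y) = y"
    using frame_op_shift_surj[OF t] by metis
  have lin: "linear_map J"
    unfolding linear_map_def
  proof (intro conjI allI)
    show "J (x + y) = J x + J y" for x y
    proof (rule inj[of t])
      have "frame_op (J x + J y) + act (t *\<^sub>R 1) (J x + J y) =
          (frame_op (J x) + act (t *\<^sub>R 1) (J x)) + (frame_op (J y) + act (t *\<^sub>R 1) (J y))"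
        by (simp add: linear_mapD[OF frame_op_linear] act_add_right add_ac)
      then show "frame_op (J (x + y)) + act (t *\<^sub>R 1) (J (x + y)) =
          frame_op (J x + J y) + act (t *\<^sub>R 1) (J x + J y)"
        by (simp only: J)
    qed (use t in simp)
    show "J (act a x) = act a (J x)" for a x
    proof (rule inj[of t])
      have "frame_op (act a (J x)) + act (t *\<^sub>R 1) (act a (J x)) =
          act a (frame_op (J x) + act (t *\<^sub>R 1) (J x))"
        by (simp add: linear_mapD[OF frame_op_linear] act_add_right act_act)
      then show "frame_op (J (act a x)) + act (t *\<^sub>R 1) (J (act a x)) =
          frame_op (act a (J x)) + act (t *\<^sub>R 1) (act a (J x))"
        by (simp only: J)
    qed (use t in simp)
  qed
  have NJ: "N (J y) \<le> M * N y" for y using M(2)[of t "J y"] t by (simp add: J)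
  define A where "A x = J (act (t *\<^sub>R 1) x)" for x
  have "linear_map A"
    by (simp add: linear_map_def A_def act_add_right linear_mapD[OF lin] act_act flip: linear_mapD(2)[OF lin])
  moreover have "N (A x) \<le> (1/2) * N x" for x
  proof -
    have "N (A x) \<le> M * N (act (t *\<^sub>R 1) x)" by (simp add: A_def NJ)
    also have "\<dots> \<le> M * (t * N x)"
      using N_scaleR[of t x] t M(1) by (intro mult_left_mono) auto
    also have "\<dots> = (1/2) * N x" using M(1) by (simp add: t_def)
    finally show ?thesis .
  qed
  ultimately have solve: "\<exists>x. x = J y + A x" for y
    using contraction_solve[of A "1/2"] by simp
  have surj: "\<exists>x. frame_op x = y" for y
  proof -
    obtain x where "x = J y + A x" using solve by blast
    then have x: "x = J (y + act (t *\<^sub>R 1) x)"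
      by (simp add: A_def linear_mapD[OF lin])
    have "frame_op x + act (t *\<^sub>R 1) x = y + act (t *\<^sub>R 1) x"
      using J[of "y + act (t *\<^sub>R 1) x"] x by simp
    then show ?thesis by auto
  qed
  have "inj frame_op"
    using inj[of 0] by (auto simp: inj_def)
  moreover have "surj frame_op" using surj by (metis surj_def)
  ultimately show ?thesis by (simp add: bij_def)
qed

text \<open>\<open>R = sqrt C (1 - L)\<close> for \<open>T = 1 - S / C\<close>. Symmetry passes from
  \<open>S\<close> to the iterates and, by Cauchy-Schwarz, to their limit; bijectivity is inherited
  from \<open>R R = S\<close>.\<close>

lemma frame_op_sqrt:
  "\<exists>R. linear_map R \<and> bij R \<and> (\<forall>x. R (R x) = frame_op x) \<and> (\<forall>x y. ip (R x) y = ip x (R y))"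
proof -
  obtain C where C: "C > 0" "\<And>x. N (x - act ((1/C) *\<^sub>R 1) (frame_op x)) \<le> N x"
    using frame_op_contraction by blast
  define T where "T x = x - act ((1/C) *\<^sub>R 1) (frame_op x)" for x
  interpret T: module_contraction act N T
  proof
    show "linear_map T"
      by (simp add: linear_map_def T_def linear_mapD[OF frame_op_linear] act_add_right act_diff_right
          act_act algebra_simps)
    show "N (T x) \<le> N x" for x by (simp add: T_def C)
  qed
  have ipT: "ip (T x) y = ip x (T y)" for x y
    by (simp add: T_def ip_diff_left ip_diff_right ip_scaleR_left ip_scaleR_right ip_frame_op_right)
  have ipY: "ip (T.Y n x) y = ip x (T.Y n y)" for n x y
    by (induction n arbitrary: x y)
      (simp_all add: ip_scaleR_left ip_scaleR_right ip_add_left ip_add_right ipT)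
  have ipL: "ip (T.L x) y = ip x (T.L y)" for x y
  proof -
    have "(\<lambda>n. norm (ip (T.Y n x) y - ip (T.L x) y)) \<longlonglongrightarrow> 0"
    proof (rule tendsto_sandwich[OF _ _ tendsto_const])
      show "(\<lambda>n. N (T.Y n x - T.L x) * N y) \<longlonglongrightarrow> 0"
        using tendsto_mult[OF T.Y_lim tendsto_const] by simp
    qed (simp_all add: norm_ip_le flip: ip_diff_left)
    then have 1: "(\<lambda>n. ip (T.Y n x) y) \<longlonglongrightarrow> ip (T.L x) y"
      unfolding tendsto_norm_zero_iff LIM_zero_iff .
    have "(\<lambda>n. norm (ip x (T.Y n y) - ip x (T.L y))) \<longlonglongrightarrow> 0"
    proof (rule tendsto_sandwich[OF _ _ tendsto_const])
      show "(\<lambda>n. N x * N (T.Y n y - T.L y)) \<longlonglongrightarrow> 0"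
        using tendsto_mult[OF tendsto_const T.Y_lim] by simp
    qed (simp_all add: norm_ip_le flip: ip_diff_right)
    then have "(\<lambda>n. ip x (T.Y n y)) \<longlonglongrightarrow> ip x (T.L y)"
      unfolding tendsto_norm_zero_iff LIM_zero_iff .
    with 1 show ?thesis unfolding ipY by (rule LIMSEQ_unique)
  qed
  define R where "R x = act (sqrt C *\<^sub>R 1) (x - T.L x)" for x
  have lin: "linear_map R"
    by (simp add: linear_map_def R_def linear_mapD[OF T.L_linear] act_add_right act_diff_right
        act_act algebra_simps)
  moreover have RR: "R (R x) = frame_op x" for x
  proof -
    have "R (R x) = act (sqrt C *\<^sub>R 1) (act (sqrt C *\<^sub>R 1) ((x - T.L x) - T.L (x - T.L x)))"
      by (simp only: R_def linear_mapD[OF T.L_linear] act_diff_right)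
    also have "\<dots> = frame_op x"
      using C(1) by (simp only: T.square_root) (simp add: T_def act_act act_one)
    finally show ?thesis .
  qed
  moreover have "bij R"
  proof -
    have "R x = R y \<Longrightarrow> x = y" for x y
      using bij_is_inj[OF frame_op_bij, THEN injD, of x y] by (simp flip: RR)
    then have "inj R" by (rule injI)
    moreover have "y = R (R (inv frame_op y))" for y
      using frame_op_bij by (simp only: RR) (simp add: bij_is_surj surj_f_inv_f)
    then have "surj R" by (rule surjI[OF sym])
    ultimately show ?thesis by (simp add: bij_def)
  qed
  moreover have "ip (R x) y = ip x (R y)" for x y
    by (simp add: R_def ip_scaleR_left ip_scaleR_right ip_diff_left ip_diff_right ipL)
  ultimately show ?thesis by blast
qed

text \<open>The frame consists of the images of the generators under the inverse square root of the
  frame operator.\<close>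

lemma normalized_tight_frame_exists:
  "\<exists>U. linear_map U \<and> bij U \<and> normalized_tight_frame ip (map U gs)"
proof -
  obtain R where R: "linear_map R" "bij R" "\<And>x. R (R x) = frame_op x"
    and sa: "\<And>x y. ip (R x) y = ip x (R y)"
    using frame_op_sqrt by blast
  define U where "U = inv R"
  have RU: "R (U x) = x" for x using R(2) by (simp add: U_def bij_is_surj surj_f_inv_f)
  have UR: "U (R x) = x" for x using R(2) by (simp add: U_def bij_is_inj)
  have "linear_map U"
    unfolding linear_map_def
  proof (intro conjI allI)
    show "U (x + y) = U x + U y" for x y
      using UR[of "U x + U y"] by (simp add: linear_mapD[OF R(1)] RU)
    show "U (act a x) = act a (U x)" for a x
      using UR[of "act a (U x)"] by (simp add: linear_mapD[OF R(1)] RU)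
  qed
  moreover have "bij U" using R(2) by (simp add: U_def bij_imp_bij_inv)
  moreover have usa: "ip (U x) y = ip x (U y)" for x y
    using sa[of "U x" "U y"] by (simp add: RU)
  have "ip x x = (\<Sum>i<length gs. ip x (U (gs ! i)) * ip (U (gs ! i)) x)" for x
  proof -
    have "(\<Sum>i<length gs. ip x (U (gs ! i)) * ip (U (gs ! i)) x) = ip (frame_op (U x)) (U x)"
      by (simp add: ip_frame_op usa[of _ x] flip: usa[of x])
    also have "\<dots> = ip (R x) (U x)" by (simp add: RU flip: R(3))
    also have "\<dots> = ip x x" by (simp add: sa RU)
    finally show ?thesis by simp
  qed
  then have "normalized_tight_frame ip (map U gs)"
    by (simp add: normalized_tight_frame_def)
  ultimately show ?thesis by blast
qed

end

section \<open>Isomorphisms and frames\<close>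

lemma module_iso_zero: "module_iso actM actN T \<Longrightarrow> T 0 = 0"
  unfolding module_iso_def by (metis add_cancel_right_right)

lemma module_iso_sum:
  assumes "module_iso actM actN T"
  shows "T (\<Sum>i\<in>A. actM (c i) (f i)) = (\<Sum>i\<in>A. actN (c i) (T (f i)))"
  using module_iso_zero[OF assms] assms
  by (induction A rule: infinite_finite_induct) (simp_all add: module_iso_def)

lemma finitely_generated_list:
  assumes "finitely_generated act"
  shows "\<exists>gs. \<forall>x. \<exists>c. x = (\<Sum>i<length gs. act (c i) (gs ! i))"
proof -
  obtain G where G: "finite G" "\<And>x. \<exists>c. x = (\<Sum>g\<in>G. act (c g) g)"
    using assms unfolding finitely_generated_def by blast
  obtain gs where gs: "set gs = G" "distinct gs" using finite_distinct_list[OF G(1)] by blast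
  have "\<exists>c. x = (\<Sum>i<length gs. act (c i) (gs ! i))" for x
  proof -
    obtain c where "x = (\<Sum>g\<in>G. act (c g) g)" using G(2) by blast
    then have "x = (\<Sum>i<length gs. act (c (gs ! i)) (gs ! i))"
      using sum.reindex_bij_betw[OF bij_betw_nth[OF gs(2) refl gs(1)[symmetric]], of "\<lambda>g. act (c g) g"]
      by simp
    then show ?thesis by (rule exI[of _ "\<lambda>i. c (gs ! i)"])
  qed
  then show ?thesis by blast
qed

text \<open>Condition (iv) asks for nonzero entries, and zero entries contribute nothing to the sum.
  In the zero module the empty list remains.\<close>

lemma normalized_tight_frame_filter:
  assumes h: "hilbert_module act ip" and f: "normalized_tight_frame ip xs"
  shows "normalized_tight_frame ip (filter (\<lambda>x. x \<noteq> 0) xs)"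
proof -
  interpret hilbert_module act ip by (rule h)
  have nth: "(\<Sum>i<length zs. ip x (zs ! i) * ip (zs ! i) x) = sum_list (map (\<lambda>z. ip x z * ip z x) zs)"
    for x zs by (simp add: sum_list_sum_nth atLeast0LessThan)
  have "sum_list (map (\<lambda>z. ip x z * ip z x) (filter (\<lambda>x. x \<noteq> 0) xs)) =
      sum_list (map (\<lambda>z. ip x z * ip z x) xs)" for x
    by (rule sum_list_map_filter) simp
  then show ?thesis using f unfolding normalized_tight_frame_def nth by simp
qed

lemma finite_frame_exists:
  assumes h: "hilbert_module act ip" and g: "finitely_generated act"
  shows "\<exists>xs. normalized_tight_frame ip xs \<and> (\<forall>i<length xs. xs ! i \<noteq> 0)"
proof -
  obtain gs where "\<And>x. \<exists>c. x = (\<Sum>i<length gs. act (c i) (gs ! i))"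
    using finitely_generated_list[OF g] by blast
  then interpret generated_hilbert_module act ip gs
    by (intro generated_hilbert_module.intro h generated_hilbert_module_axioms.intro)
  obtain U where "normalized_tight_frame ip (map U gs)"
    using normalized_tight_frame_exists by blast
  moreover have "zs ! i \<noteq> 0" if "zs = filter (\<lambda>x. x \<noteq> 0) (map U gs)" "i < length zs" for zs i
    using nth_mem[OF that(2)] that(1) by simp
  ultimately show ?thesis using normalized_tight_frame_filter[OF h] by blast
qed

text \<open>Both Gram matrices are self-adjoint idempotents whose kernel is the module of relations
  of the common frame, hence they agree.\<close>

lemma gram_eq_of_module_iso:
  assumes hM: "hilbert_module actM ipM" and hN: "hilbert_module actN ipN"
    and V: "module_iso actM actN V"
    and fM: "normalized_tight_frame ipM xs" and fN: "normalized_tight_frame ipN (map V xs)"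
    and jk: "j < length xs" "k < length xs"
  shows "ipM (xs ! j) (xs ! k) = ipN (V (xs ! j)) (V (xs ! k))"
proof -
  interpret M: hilbert_module actM ipM by (rule hM)
  interpret N: hilbert_module actN ipN by (rule hN)
  define P where "P i j = ipM (xs ! i) (xs ! j)" for i j
  define Q where "Q i j = ipN (V (xs ! i)) (V (xs ! j))" for i j
  have x: "xs ! j = (\<Sum>i<length xs. actM (P j i) (xs ! i))" for j
    unfolding P_def by (rule M.normalized_tight_frame_expansion[OF fM])
  have y: "V (xs ! j) = (\<Sum>i<length xs. actN (Q j i) (V (xs ! i)))" for j
    using N.normalized_tight_frame_expansion[OF fN, of "V (xs ! j)"] by (simp add: Q_def)
  have inj: "inj V" using V by (simp add: module_iso_def bij_is_inj)
  have "V (xs ! j) = (\<Sum>i<length xs. actN (P j i) (V (xs ! i)))"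
    using arg_cong[OF x[of j], of V] by (simp add: module_iso_sum[OF V])
  then have 1: "Q j k = (\<Sum>i<length xs. P j i * Q i k)"
    unfolding Q_def[of j] by (simp add: N.ip_sum_left N.ip_act_left Q_def)
  \<comment> \<open>Pulled back through the injective \<open>V\<close>, the expansion of
    \<open>V x\<^sub>k\<close> has coefficients \<open>Q\<close> on the \<open>x\<^sub>i\<close>, so
    \<open>P = Q P\<close>; adjoints turn this into \<open>P = P Q\<close>, which meets
    \<open>Q = P Q\<close>.\<close>
  have "V (xs ! k) = V (\<Sum>i<length xs. actM (Q k i) (xs ! i))"
    using y[of k] by (simp add: module_iso_sum[OF V])
  then have "xs ! k = (\<Sum>i<length xs. actM (Q k i) (xs ! i))"
    using inj by (simp add: inj_eq)
  then have "P k j = (\<Sum>i<length xs. Q k i * P i j)"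
    unfolding P_def[of k] by (simp add: M.ip_sum_left M.ip_act_left P_def)
  then have "star (P k j) = (\<Sum>i<length xs. star (P i j) * star (Q k i))"
    by (simp add: star_sum star_mult)
  moreover have "star (P b a) = P a b" "star (Q b a) = Q a b" for a b
    unfolding P_def Q_def by (simp_all flip: M.ip_star N.ip_star)
  ultimately have "P j k = (\<Sum>i<length xs. P j i * Q i k)" by simp
  with 1 have "P j k = Q j k" by simp
  then show ?thesis by (simp add: P_def Q_def)
qed

text \<open>Taking the images of a frame of the source as generators of the target makes both frames
  satisfy the same linear relations.\<close>

lemma frames_of_module_iso:
  assumes hM: "hilbert_module actM ipM" and gM: "finitely_generated actM"
    and hN: "hilbert_module actN ipN" and T: "module_iso actM actN T"
  shows "\<exists>xs ys. normalized_tight_frame ipM xs \<and> normalized_tight_frame ipN ys \<and>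
    length xs = length ys \<and> (\<forall>i<length xs. xs ! i \<noteq> 0 \<and> ys ! i \<noteq> 0) \<and>
    (\<forall>i<length xs. \<forall>j<length xs. ipM (xs ! i) (xs ! j) = ipN (ys ! i) (ys ! j))"
proof -
  interpret M: hilbert_module actM ipM by (rule hM)
  obtain xs where xs: "normalized_tight_frame ipM xs" "\<And>i. i < length xs \<Longrightarrow> xs ! i \<noteq> 0"
    using finite_frame_exists[OF hM gM] by blast
  have "\<exists>c. y = (\<Sum>i<length (map T xs). actN (c i) (map T xs ! i))" for y
  proof -
    obtain x where "y = T x" using T unfolding module_iso_def by (metis bij_pointE)
    then have "y = T (\<Sum>i<length xs. actM (ipM x (xs ! i)) (xs ! i))"
      using M.normalized_tight_frame_expansion[OF xs(1), of x] by simp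
    then show ?thesis by (auto simp: module_iso_sum[OF T])
  qed
  then interpret N: generated_hilbert_module actN ipN "map T xs"
    by (intro generated_hilbert_module.intro hN generated_hilbert_module_axioms.intro)
  obtain U where U: "N.linear_map U" "bij U" "normalized_tight_frame ipN (map U (map T xs))"
    using N.normalized_tight_frame_exists by blast
  define V where "V = U \<circ> T"
  have V: "module_iso actM actN V"
    using T U(2) by (simp add: module_iso_def V_def bij_comp N.linear_mapD[OF U(1)])
  have f: "normalized_tight_frame ipN (map V xs)" using U(3) by (simp add: V_def)
  have "V x \<noteq> 0" if "x \<noteq> 0" for x
    using that V module_iso_zero[OF V] by (metis bij_is_inj injD module_iso_def)
  then show ?thesis
    using xs f gram_eq_of_module_iso[OF hM hN V xs(1) f]
    by (intro exI[of _ xs] exI[of _ "map V xs"]) simp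
qed

text \<open>Equal Gram matrices mean that \<open>T u\<close> has against \<open>ys\<close> the
  coefficients of \<open>u\<close> against \<open>xs\<close> (\<open>ipx\<close>), and these
  determine the inner products. Surjectivity comes from \<open>T\<close> sending \<open>xs\<close>
  to \<open>ys\<close>.\<close>

lemma unitary_of_frames:
  assumes hM: "hilbert_module actM ipM" and hN: "hilbert_module actN ipN"
    and fM: "normalized_tight_frame ipM xs" and fN: "normalized_tight_frame ipN ys"
    and len: "length xs = length ys"
    and gram: "\<And>i j. i < length xs \<Longrightarrow> j < length xs \<Longrightarrow> ipM (xs ! i) (xs ! j) = ipN (ys ! i) (ys ! j)"
  shows "unitarily_isomorphic actM ipM actN ipN"
proof -
  interpret M: hilbert_module actM ipM by (rule hM)
  interpret N: hilbert_module actN ipN by (rule hN)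
  let ?I = "{..<length xs}"
  define T where "T x = (\<Sum>i\<in>?I. actN (ipM x (xs ! i)) (ys ! i))" for x
  have x: "x = (\<Sum>i\<in>?I. actM (ipM x (xs ! i)) (xs ! i))" for x
    by (rule M.normalized_tight_frame_expansion[OF fM])
  have y: "y = (\<Sum>i\<in>?I. actN (ipN y (ys ! i)) (ys ! i))" for y
    using N.normalized_tight_frame_expansion[OF fN] by (simp add: len)
  have Tadd: "T (u + v) = T u + T v" for u v
    by (simp add: T_def M.ip_add_left N.act_add_left sum.distrib)
  have Tact: "T (actM a u) = actN a (T u)" for a u
    by (simp add: T_def M.ip_act_left N.act_sum_right N.act_act)
  have Tsum: "T (\<Sum>i\<in>A. actM (c i) (f i)) = (\<Sum>i\<in>A. actN (c i) (T (f i)))"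
    for A :: "nat set" and c and f
  proof -
    have "T 0 = 0" using Tadd[of 0 0] by simp
    then show ?thesis by (induction A rule: infinite_finite_induct) (simp_all add: Tadd Tact)
  qed
  have Tx: "T (xs ! j) = ys ! j" if "j \<in> ?I" for j
  proof -
    have "T (xs ! j) = (\<Sum>i\<in>?I. actN (ipN (ys ! j) (ys ! i)) (ys ! i))"
      unfolding T_def using that by (intro sum.cong) (simp_all add: gram)
    then show ?thesis by (simp flip: y)
  qed
  have ipx: "ipN (T u) (ys ! j) = ipM u (xs ! j)" if "j \<in> ?I" for u j
  proof -
    have "ipN (T u) (ys ! j) = (\<Sum>i\<in>?I. ipM u (xs ! i) * ipN (ys ! i) (ys ! j))"
      by (simp add: T_def N.ip_sum_left N.ip_act_left)
    also have "\<dots> = (\<Sum>i\<in>?I. ipM u (xs ! i) * ipM (xs ! i) (xs ! j))"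
      using that by (intro sum.cong) (simp_all add: gram)
    also have "\<dots> = ipM (\<Sum>i\<in>?I. actM (ipM u (xs ! i)) (xs ! i)) (xs ! j)"
      by (simp add: M.ip_sum_left M.ip_act_left)
    finally show ?thesis by (simp flip: x)
  qed
  have ipT: "ipN (T u) (T v) = ipM u v" for u v
  proof -
    have "ipN (T u) (T v) = (\<Sum>i\<in>?I. ipN (T u) (ys ! i) * star (ipM v (xs ! i)))"
      by (simp add: T_def[of v] N.ip_sum_right N.ip_act_right)
    also have "\<dots> = (\<Sum>i\<in>?I. ipM u (xs ! i) * star (ipM v (xs ! i)))"
      by (intro sum.cong) (simp_all add: ipx)
    also have "\<dots> = ipM u (\<Sum>i\<in>?I. actM (ipM v (xs ! i)) (xs ! i))"
      by (simp add: M.ip_sum_right M.ip_act_right)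
    finally show ?thesis by (simp flip: x)
  qed
  have "inj T"
  proof (rule injI)
    fix u v assume "T u = T v"
    then have "ipM u w = ipM v w" for w by (metis ipT)
    then show "u = v" by (rule M.ip_eqI)
  qed
  moreover have "surj T"
  proof (rule surjI)
    fix v
    have "T (\<Sum>i\<in>?I. actM (ipN v (ys ! i)) (xs ! i)) = (\<Sum>i\<in>?I. actN (ipN v (ys ! i)) (ys ! i))"
      unfolding Tsum by (intro sum.cong) (simp_all add: Tx)
    then show "T (\<Sum>i\<in>?I. actM (ipN v (ys ! i)) (xs ! i)) = v" by (simp flip: y)
  qed
  ultimately have "module_iso actM actN T" by (simp add: module_iso_def bij_def Tadd Tact)
  then show ?thesis using ipT unfolding unitarily_isomorphic_def by blast
qed

lemma unitarily_imp_isometrically_isomorphic: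
  "unitarily_isomorphic actM ipM actN ipN \<Longrightarrow> isometrically_isomorphic actM ipM actN ipN"
  unfolding unitarily_isomorphic_def isometrically_isomorphic_def hilbert_norm_def by metis

lemma isometrically_imp_algebraically_isomorphic:
  "isometrically_isomorphic actM ipM actN ipN \<Longrightarrow> algebraically_isomorphic actM actN"
  unfolding isometrically_isomorphic_def algebraically_isomorphic_def by blast

theorem theorem3p2:
  fixes actM :: "'b::unital_cstar_algebra \<Rightarrow> 'm::ab_group_add \<Rightarrow> 'm"
    and ipM :: "'m \<Rightarrow> 'm \<Rightarrow> 'b"
    and actN :: "'b \<Rightarrow> 'n::ab_group_add \<Rightarrow> 'n"
    and ipN :: "'n \<Rightarrow> 'n \<Rightarrow> 'b"
  assumes "hilbert_module actM ipM" and "finitely_generated actM"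
    and "hilbert_module actN ipN" and "finitely_generated actN"
  shows "(algebraically_isomorphic actM actN \<longleftrightarrow>
            isometrically_isomorphic actM ipM actN ipN) \<and>
         (isometrically_isomorphic actM ipM actN ipN \<longleftrightarrow>
            unitarily_isomorphic actM ipM actN ipN) \<and>
         (unitarily_isomorphic actM ipM actN ipN \<longleftrightarrow>
            (\<exists>xs ys. normalized_tight_frame ipM xs \<and> normalized_tight_frame ipN ys \<and>
               length xs = length ys \<and>
               (\<forall>i<length xs. xs ! i \<noteq> 0 \<and> ys ! i \<noteq> 0) \<and>
               (\<forall>i<length xs. \<forall>j<length xs.
                  ipM (xs ! i) (xs ! j) = ipN (ys ! i) (ys ! j))))"
    (is "(?alg \<longleftrightarrow> ?isom) \<and> (?isom \<longleftrightarrow> ?unit) \<and> (?unit \<longleftrightarrow> ?frames)")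
proof -
  \<comment> \<open>The implications close the circle (i), (iv), (iii), (ii), (i).\<close>
  have "?alg \<Longrightarrow> ?frames"
    unfolding algebraically_isomorphic_def
    using frames_of_module_iso[OF assms(1,2,3)] by blast
  moreover have "?frames \<Longrightarrow> ?unit"
    using unitary_of_frames[OF assms(1,3)] by blast
  moreover have "?unit \<Longrightarrow> ?isom" by (rule unitarily_imp_isometrically_isomorphic)
  moreover have "?isom \<Longrightarrow> ?alg" by (rule isometrically_imp_algebraically_isomorphic)
  ultimately show ?thesis by argo
qed

end
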